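(* Let $\Omega\subset\mathbb{R}^{n}$ be a smoothly bounded domain and $p\in b\Omega$. Let $\sigma$ be a smooth local defining function for $\Omega$ on a neighborhood $U\subset\mathbb{R}^{n}$ of $p$ satisfying $\|\nabla\sigma\|=1$ on $b\Omega\cap U$, and suppose $\Omega$ is convex on $U$. For $\alpha,\beta>0$ define $B_{\alpha,\beta}(x)=\alpha+\beta\|x\|^{2}$ for $x\in\mathbb{R}^{n}$. Then there exist a neighborhood $W\subset U$ of $p$ and constants $\alpha,\beta>0$ such that the function $$\tilde\sigma(x)=\tilde\sigma_{\alpha,\beta}(x)=\sigma(x)+B_{\alpha,\beta}(x)\cdot\sigma^{2}(x)$$ is a local defining function for $\Omega$ on $W$ and satisfies $$\sum_{j,k=1}^{n}\frac{\partial^{2}\tilde\sigma}{\partial x_{j}\partial x_{k}}(x)\,\xi_{j}\xi_{k}\geq 0\qquad\text{for all }x\in W,\ \xi\in\mathbb{R}^{n}.$$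
   Context: Smooth means $C^{\infty}$; neighborhoods are open; $b\Omega$ denotes the topological boundary of $\Omega$. An open set $\Omega\subset\mathbb{R}^{n}$ is smoothly bounded if there is a $C^{\infty}$ function $r:\mathbb{R}^{n}\to\mathbb{R}$ (a defining function) with $\Omega=\{r<0\}$ and $\nabla r\neq 0$ in a neighborhood of $\{r=0\}=b\Omega$. A local defining function for $\Omega$ on an open set $U$ is a function $\sigma:U\to\mathbb{R}$ with $\Omega\cap U=\{x\in U:\sigma(x)<0\}$. The tangent space at $x\in b\Omega$ is $T_{x}(b\Omega)=\{\xi\in\mathbb{R}^{n}:\langle\nabla r(x),\xi\rangle=0\}$; it does not depend on the choice of $r$. $\Omega$ is convex on an open set $U$ if $\sum_{j,k}\frac{\partial^{2}r}{\partial x_{j}\partial x_{k}}(q)\,\tau_{j}\tau_{k}\geq 0$ for all $q\in b\Omega\cap U$ and all $\tau\in T_{q}(b\Omega)$ (this does not depend on the choice of $r$). *)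

theory Defs
  imports "HOL-Analysis.Analysis"
begin

definition partial_deriv :: "'n \<Rightarrow> (real ^ 'n \<Rightarrow> real) \<Rightarrow> real ^ 'n \<Rightarrow> real" where
  "partial_deriv j f x = deriv (\<lambda>t. f (x + t *\<^sub>R axis j 1)) 0"

definition grad :: "(real ^ 'n \<Rightarrow> real) \<Rightarrow> real ^ 'n \<Rightarrow> real ^ 'n" where
  "grad f x = (\<chi> j. partial_deriv j f x)"

definition hessian_form :: "(real ^ 'n \<Rightarrow> real) \<Rightarrow> real ^ 'n \<Rightarrow> real ^ 'n \<Rightarrow> real" where
  "hessian_form f x \<xi> =
     (\<Sum>j\<in>UNIV. \<Sum>k\<in>UNIV. partial_deriv j (partial_deriv k f) x * \<xi> $ j * \<xi> $ k)"

(* C^k on U. Only meaningful for open U: the derivatives are the unrestricted ones at points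
   of U, and they depend on the values of f inside U only because U is open. Differentiability
   in the recursive step is total (Frechet) differentiability. *)
primrec Ck_on :: "nat \<Rightarrow> (real ^ 'n) set \<Rightarrow> (real ^ 'n \<Rightarrow> real) \<Rightarrow> bool" where
  "Ck_on 0 U f \<longleftrightarrow> continuous_on U f"
| "Ck_on (Suc k) U f \<longleftrightarrow>
     (\<forall>x\<in>U. f differentiable (at x)) \<and> (\<forall>j. Ck_on k U (partial_deriv j f))"

definition smooth_on :: "(real ^ 'n) set \<Rightarrow> (real ^ 'n \<Rightarrow> real) \<Rightarrow> bool" where
  "smooth_on U f \<longleftrightarrow> (\<forall>k. Ck_on k U f)"

definition defining_function :: "(real ^ 'n \<Rightarrow> real) \<Rightarrow> (real ^ 'n) set \<Rightarrow> bool" where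
  "defining_function r \<Omega> \<longleftrightarrow>
     smooth_on UNIV r \<and> \<Omega> = {x. r x < 0} \<and> {x. r x = 0} = frontier \<Omega> \<and>
     (\<exists>V. open V \<and> {x. r x = 0} \<subseteq> V \<and> (\<forall>x\<in>V. grad r x \<noteq> 0))"

(* Boundedness of the set is not part of this notion. *)
definition smoothly_bounded :: "(real ^ 'n) set \<Rightarrow> bool" where
  "smoothly_bounded \<Omega> \<longleftrightarrow> open \<Omega> \<and> (\<exists>r. defining_function r \<Omega>)"

(* Smoothness is not part of this notion. Functions are total; values outside U are irrelevant. *)
definition local_defining_function ::
    "(real ^ 'n \<Rightarrow> real) \<Rightarrow> (real ^ 'n) set \<Rightarrow> (real ^ 'n) set \<Rightarrow> bool" where
  "local_defining_function \<sigma> \<Omega> U \<longleftrightarrow> open U \<and> \<Omega> \<inter> U = {x \<in> U. \<sigma> x < 0}"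

(* The tangent space at a boundary point x of the set defined by r. *)
definition tangent_space :: "(real ^ 'n \<Rightarrow> real) \<Rightarrow> real ^ 'n \<Rightarrow> (real ^ 'n) set" where
  "tangent_space r x = {\<xi>. grad r x \<bullet> \<xi> = 0}"

(* The condition does not depend on the choice of the defining function r, so "for some r" and
   "for every r" agree for a smoothly bounded set; as a hypothesis, "for some r" is the form
   that presupposes nothing about this independence. *)
definition convex_boundary_on :: "(real ^ 'n) set \<Rightarrow> (real ^ 'n) set \<Rightarrow> bool" where
  "convex_boundary_on \<Omega> U \<longleftrightarrow>
     (\<exists>r. defining_function r \<Omega> \<and>
          (\<forall>q \<in> frontier \<Omega> \<inter> U. \<forall>\<tau> \<in> tangent_space r q. 0 \<le> hessian_form r q \<tau>))"

definition B :: "real \<Rightarrow> real \<Rightarrow> real ^ 'n \<Rightarrow> real" where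
  "B \<alpha> \<beta> x = \<alpha> + \<beta> * (norm x)\<^sup>2"

definition sigma_tilde ::
    "(real ^ 'n \<Rightarrow> real) \<Rightarrow> real \<Rightarrow> real \<Rightarrow> real ^ 'n \<Rightarrow> real" where
  "sigma_tilde \<sigma> \<alpha> \<beta> x = \<sigma> x + B \<alpha> \<beta> x * (\<sigma> x)\<^sup>2"

end

theory Submission
  imports Defs
begin

text \<open>
  Let \<open>q\<close> be a boundary point with normal \<open>\<nu> = \<nabla>\<sigma>(q)\<close> and Hessian \<open>A\<close> of \<open>\<sigma>\<close> at \<open>q\<close>, and let \<open>\<tau> \<bottom> \<nu>\<close>.
  Since \<open>|\<nabla>\<sigma>|\<^sup>2 - 1\<close> vanishes on the boundary, differentiating it once and twice along the boundary
  gives \<open>\<nu> \<bullet> A\<tau> = 0\<close> and \<open>D\<^sup>3\<sigma>(\<nu>,\<tau>,\<tau>) = (\<nu> \<bullet> A\<nu>)(\<tau> \<bullet> A\<tau>) - |A\<tau>|\<^sup>2\<close>.  Convexity makes \<open>A\<close> positive semidefinite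
  on the tangent space, so Cauchy-Schwarz bounds the third derivative by a multiple of \<open>\<tau> \<bullet> A\<tau>\<close>.
  For \<open>x\<close> near the boundary with nearest boundary point \<open>q\<close> we have \<open>x = q + s\<nu>\<close>, and a Taylor expansion
  in \<open>s\<close> shows that the Hessian of \<open>\<sigma>\<close> at \<open>x\<close> loses only \<open>O(s\<^sup>2)\<close> in tangential directions, whence
  \<open>Hess \<sigma>(x)(\<xi>,\<xi>) \<ge> - M (\<sigma>(x)\<^sup>2 |\<xi>|\<^sup>2 + (\<nabla>\<sigma>(x) \<bullet> \<xi>)\<^sup>2)\<close>.
  The term \<open>\<alpha>\<sigma>\<^sup>2\<close> absorbs the normal part of this defect and \<open>\<beta>|x|\<^sup>2\<sigma>\<^sup>2\<close> the part proportional to \<open>\<sigma>\<^sup>2\<close>.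
\<close>

subsection \<open>Twice differentiable functions\<close>

text \<open>Gradient and Hessian are carried as explicit functions, so that the sum and product
  rules below assemble those of a composite function by unification. Symmetry of \<open>H\<close> is
  a consequence, derived later on open sets.\<close>

definition twice_diff_on ::
    "(real ^ 'n) set \<Rightarrow> (real ^ 'n \<Rightarrow> real) \<Rightarrow> (real ^ 'n \<Rightarrow> real ^ 'n) \<Rightarrow> (real ^ 'n \<Rightarrow> real ^ 'n ^ 'n) \<Rightarrow> bool"
  where
  "twice_diff_on U f g H \<longleftrightarrow>
     (\<forall>x\<in>U. (f has_derivative (\<lambda>h. g x \<bullet> h)) (at x)) \<and>
     (\<forall>x\<in>U. (g has_derivative (\<lambda>h. H x *v h)) (at x)) \<and> continuous_on U H"

lemma twice_diff_onD:
  assumes "twice_diff_on U f g H"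
  shows "x \<in> U \<Longrightarrow> (f has_derivative (\<lambda>h. g x \<bullet> h)) (at x)"
    and "x \<in> U \<Longrightarrow> (g has_derivative (\<lambda>h. H x *v h)) (at x)"
    and "continuous_on U H"
  using assms by (auto simp: twice_diff_on_def)

lemma twice_diff_on_subset:
  assumes "twice_diff_on U f g H" "V \<subseteq> U"
  shows "twice_diff_on V f g H"
  using assms by (auto simp: twice_diff_on_def intro: continuous_on_subset)

lemma twice_diff_on_continuous:
  assumes "twice_diff_on U f g H"
  shows "continuous_on U f" "continuous_on U g"
  by (auto intro!: continuous_at_imp_continuous_on
      has_derivative_continuous[OF twice_diff_onD(1)[OF assms]]
      has_derivative_continuous[OF twice_diff_onD(2)[OF assms]])

definition outer :: "real ^ 'n \<Rightarrow> real ^ 'n \<Rightarrow> real ^ 'n ^ 'n" where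
  "outer u v = (\<chi> i j. u $ i * v $ j)"

lemma outer_mult_vec: "outer u v *v h = (v \<bullet> h) *\<^sub>R u"
  by (simp add: vec_eq_iff outer_def matrix_vector_mult_def inner_vec_def sum_distrib_left algebra_simps)

lemma continuous_on_outer [continuous_intros]:
  assumes "continuous_on S f" "continuous_on S g"
  shows "continuous_on S (\<lambda>x. outer (f x) (g x))"
  unfolding outer_def using assms by (intro continuous_intros)

lemma scaleR_matrix_vector_mult: "(c *\<^sub>R A) *v (h :: real ^ 'n) = c *\<^sub>R (A *v h)" for A :: "real ^ 'n ^ 'm"
  by (simp add: scaleR_matrix_vector_assoc)

lemma twice_diff_on_const: "twice_diff_on U (\<lambda>x. c) (\<lambda>x. 0) (\<lambda>x. 0)"
  by (simp add: twice_diff_on_def matrix_vector_mult_def zero_vec_def[symmetric])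

lemma twice_diff_on_add:
  assumes "twice_diff_on U f g H" "twice_diff_on U f' g' H'"
  shows "twice_diff_on U (\<lambda>x. f x + f' x) (\<lambda>x. g x + g' x) (\<lambda>x. H x + H' x)"
  using assms
  by (auto simp: twice_diff_on_def inner_add_left matrix_vector_mult_add_rdistrib
      intro!: has_derivative_add continuous_on_add)

lemma twice_diff_on_mult:
  assumes "twice_diff_on U f g H" "twice_diff_on U f' g' H'"
  shows "twice_diff_on U (\<lambda>x. f x * f' x) (\<lambda>x. f x *\<^sub>R g' x + f' x *\<^sub>R g x)
     (\<lambda>x. f x *\<^sub>R H' x + f' x *\<^sub>R H x + outer (g' x) (g x) + outer (g x) (g' x))"
  unfolding twice_diff_on_def
proof (intro conjI ballI)
  fix x assume x: "x \<in> U"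
  show "((\<lambda>x. f x * f' x) has_derivative (\<lambda>h. (f x *\<^sub>R g' x + f' x *\<^sub>R g x) \<bullet> h)) (at x)"
    by (rule has_derivative_eq_rhs[OF has_derivative_mult])
      (use twice_diff_onD(1)[OF assms(1) x] twice_diff_onD(1)[OF assms(2) x]
        in \<open>auto simp: inner_add_left algebra_simps\<close>)
  have "((\<lambda>x. f x *\<^sub>R g' x + f' x *\<^sub>R g x) has_derivative
      (\<lambda>h. (f x *\<^sub>R (H' x *v h) + (g x \<bullet> h) *\<^sub>R g' x) + (f' x *\<^sub>R (H x *v h) + (g' x \<bullet> h) *\<^sub>R g x))) (at x)"
    by (intro has_derivative_add has_derivative_scaleR twice_diff_onD(1,2)[OF assms(1) x] twice_diff_onD(1,2)[OF assms(2) x])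
  then show "((\<lambda>x. f x *\<^sub>R g' x + f' x *\<^sub>R g x) has_derivative
     (\<lambda>h. (f x *\<^sub>R H' x + f' x *\<^sub>R H x + outer (g' x) (g x) + outer (g x) (g' x)) *v h)) (at x)"
    by (simp add: matrix_vector_mult_add_rdistrib scaleR_matrix_vector_mult outer_mult_vec algebra_simps)
next
  show "continuous_on U (\<lambda>x. f x *\<^sub>R H' x + f' x *\<^sub>R H x + outer (g' x) (g x) + outer (g x) (g' x))"
    by (intro continuous_intros twice_diff_onD(3)[OF assms(1)] twice_diff_onD(3)[OF assms(2)]
       twice_diff_on_continuous[OF assms(1)] twice_diff_on_continuous[OF assms(2)])
qed

lemma twice_diff_on_cmult:
  assumes "twice_diff_on U f g H"
  shows "twice_diff_on U (\<lambda>x. c * f x) (\<lambda>x. c *\<^sub>R g x) (\<lambda>x. c *\<^sub>R H x)"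
  using assms
  by (auto simp: twice_diff_on_def scaleR_matrix_vector_mult
      intro!: has_derivative_mult_right has_derivative_scaleR_right continuous_intros)

lemma twice_diff_on_sum:
  assumes "\<And>i. i \<in> I \<Longrightarrow> twice_diff_on U (f i) (g i) (H i)"
  shows "twice_diff_on U (\<lambda>x. \<Sum>i\<in>I. f i x) (\<lambda>x. \<Sum>i\<in>I. g i x) (\<lambda>x. \<Sum>i\<in>I. H i x)"
  using assms
  by (induction I rule: infinite_finite_induct) (auto intro!: twice_diff_on_const twice_diff_on_add)

lemma mat_mult_vec: "mat c *v h = c *\<^sub>R (h :: real ^ 'n)"
  by (simp add: vec_eq_iff matrix_vector_mult_def mat_def if_distrib if_distribR sum.delta cong: if_cong)

lemma twice_diff_on_norm_power2:
  "twice_diff_on U (\<lambda>x. (norm x)\<^sup>2) (\<lambda>x. 2 *\<^sub>R x) (\<lambda>x. mat 2)"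
  unfolding twice_diff_on_def power2_norm_eq_inner mat_mult_vec
  by (auto intro!: derivative_eq_intros simp: inner_commute)

subsection \<open>Partial derivatives and smooth functions\<close>

lemma partial_deriv_eq:
  assumes "(f has_derivative f') (at x)"
  shows "partial_deriv j f x = f' (axis j 1)"
proof -
  have "((\<lambda>t. x + t *\<^sub>R axis j 1) has_derivative (\<lambda>t. t *\<^sub>R axis j 1)) (at (0::real))"
    by (auto intro!: derivative_eq_intros)
  then have "((\<lambda>t. f (x + t *\<^sub>R axis j 1)) has_derivative (\<lambda>t. f' (t *\<^sub>R axis j 1))) (at 0)"
    by (rule has_derivative_compose) (use assms in simp)
  then have "((\<lambda>t. f (x + t *\<^sub>R axis j 1)) has_derivative (\<lambda>t. f' (axis j 1) * t)) (at 0)"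
    by (simp add: linear_scale[OF has_derivative_linear[OF assms]] mult.commute)
  then show ?thesis
    unfolding partial_deriv_def by (intro DERIV_imp_deriv) (simp add: has_field_derivative_def)
qed

lemma has_derivative_grad:
  assumes "f differentiable (at x)"
  shows "(f has_derivative (\<lambda>h. grad f x \<bullet> h)) (at x)"
proof -
  obtain f' where f': "(f has_derivative f') (at x)"
    using assms by (auto simp: differentiable_def)
  have "f' h = grad f x \<bullet> h" for h
  proof -
    have "f' h = f' (\<Sum>i\<in>UNIV. (h $ i) *\<^sub>R axis i 1)"
      by (simp add: basis_expansion scalar_mult_eq_scaleR[symmetric])
    also have "\<dots> = (\<Sum>i\<in>UNIV. h $ i * partial_deriv i f x)"
      using has_derivative_linear[OF f']
      by (simp add: linear_sum linear_scale partial_deriv_eq[OF f'])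
    finally show ?thesis
      by (simp add: inner_vec_def grad_def mult.commute)
  qed
  then have "f' = (\<lambda>h. grad f x \<bullet> h)" by (rule ext)
  with f' show ?thesis by metis
qed

lemma grad_eq:
  assumes "(f has_derivative (\<lambda>h. g \<bullet> h)) (at x)"
  shows "grad f x = g"
  using partial_deriv_eq[OF assms] by (simp add: grad_def vec_eq_iff inner_axis)

lemma smooth_on_partial_deriv:
  assumes "smooth_on U f"
  shows "smooth_on U (partial_deriv j f)"
  using assms unfolding smooth_on_def by (metis Ck_on.simps(2))

lemma smooth_on_subset:
  assumes "smooth_on U f" "V \<subseteq> U"
  shows "smooth_on V f"
proof -
  have "Ck_on k U f \<Longrightarrow> Ck_on k V f" for k
    using assms(2) by (induction k arbitrary: f) (auto intro: continuous_on_subset)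
  then show ?thesis using assms(1) by (simp add: smooth_on_def)
qed

lemma smooth_on_continuous:
  assumes "smooth_on U f"
  shows "continuous_on U f"
  using assms unfolding smooth_on_def by (metis Ck_on.simps(1))

lemma smooth_on_has_derivative:
  assumes "smooth_on U f" "x \<in> U"
  shows "(f has_derivative (\<lambda>h. grad f x \<bullet> h)) (at x)"
  using assms unfolding smooth_on_def by (metis Ck_on.simps(2) has_derivative_grad)

text \<open>With this order of indices, \<open>hessian f x *v h\<close> is the derivative of
  \<open>grad f\<close> in the direction \<open>h\<close> by construction.\<close>

definition hessian :: "(real ^ 'n \<Rightarrow> real) \<Rightarrow> real ^ 'n \<Rightarrow> real ^ 'n ^ 'n" where
  "hessian f x = (\<chi> k. grad (partial_deriv k f) x)"

lemma smooth_on_twice_diff_on: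
  fixes f :: "real ^ 'n \<Rightarrow> real"
  assumes "smooth_on U f"
  shows "twice_diff_on U f (grad f) (hessian f)"
  unfolding twice_diff_on_def
proof (intro conjI ballI)
  fix x assume x: "x \<in> U"
  show "(f has_derivative (\<lambda>h. grad f x \<bullet> h)) (at x)"
    using assms x by (rule smooth_on_has_derivative)
  show "(grad f has_derivative (\<lambda>h. hessian f x *v h)) (at x)"
  proof (subst has_derivative_componentwise_within, intro ballI)
    fix b :: "real ^ 'n" assume "b \<in> Basis"
    then obtain k where b: "b = axis k 1" by (rule axis_inverse[THEN exE])
    show "((\<lambda>x. grad f x \<bullet> b) has_derivative (\<lambda>h. (hessian f x *v h) \<bullet> b)) (at x)"
      using smooth_on_has_derivative[OF smooth_on_partial_deriv[OF assms] x, of k]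
      by (simp add: b inner_axis grad_def matrix_vector_mul_component hessian_def)
  qed
next
  have "continuous_on U (\<lambda>x. \<chi> k. \<chi> j. partial_deriv j (partial_deriv k f) x)"
    by (intro continuous_on_vec_lambda smooth_on_continuous smooth_on_partial_deriv assms)
  then show "continuous_on U (hessian f)"
    by (simp add: hessian_def[abs_def] grad_def)
qed

lemma hessian_form_eq:
  assumes "twice_diff_on U f g H" "open U" "x \<in> U"
  shows "hessian_form f x \<xi> = \<xi> \<bullet> (H x *v \<xi>)"
proof -
  have p: "partial_deriv k f y = g y $ k" if "y \<in> U" for k y
    using partial_deriv_eq[OF twice_diff_onD(1)[OF assms(1) that]] by (simp add: inner_axis)
  have "(g has_derivative (\<lambda>h. H x *v h)) (at x)"
    using assms twice_diff_onD(2) by blast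
  then have "((\<lambda>y. g y $ k) has_derivative (\<lambda>h. (H x *v h) $ k)) (at x)" for k
    by (rule bounded_linear.has_derivative[OF bounded_linear_vec_nth])
  then have "(partial_deriv k f has_derivative (\<lambda>h. (H x *v h) $ k)) (at x)" for k
    by (rule has_derivative_transform_within_open[OF _ assms(2,3)]) (simp add: p)
  from partial_deriv_eq[OF this] have "partial_deriv j (partial_deriv k f) x = H x $ k $ j" for j k
    by (simp add: matrix_vector_mul_component inner_axis)
  then have "hessian_form f x \<xi> = (\<Sum>j\<in>UNIV. \<Sum>k\<in>UNIV. H x $ k $ j * \<xi> $ j * \<xi> $ k)"
    by (simp add: hessian_form_def)
  \<comment> \<open>The mixed derivatives appear as \<open>H x $ k $ j\<close>, with transposed
    indices; exchanging the sums aligns them with \<open>H x *v \<xi>\<close>.\<close>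
  also have "\<dots> = (\<Sum>k\<in>UNIV. \<Sum>j\<in>UNIV. H x $ k $ j * \<xi> $ j * \<xi> $ k)"
    by (rule sum.swap)
  finally show ?thesis
    by (simp add: inner_vec_def matrix_vector_mult_def sum_distrib_left mult_ac)
qed

subsection \<open>Taylor expansion and symmetry of the second derivative\<close>

lemma has_real_derivative_line:
  assumes "(f has_derivative f') (at (q + t *\<^sub>R h))"
  shows "((\<lambda>t. f (q + t *\<^sub>R h)) has_real_derivative f' h) (at t)"
proof -
  have "((\<lambda>t. q + t *\<^sub>R h) has_derivative (\<lambda>t. t *\<^sub>R h)) (at t)"
    by (auto intro!: derivative_eq_intros)
  from has_derivative_compose[OF this assms]
  have "((\<lambda>t. f (q + t *\<^sub>R h)) has_derivative (\<lambda>s. f' h * s)) (at t)"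
    by (simp add: linear_scale[OF has_derivative_linear[OF assms]] mult.commute)
  then show ?thesis by (simp add: has_field_derivative_def)
qed

text \<open>Maclaurin's formula of order 2 on the line through \<open>q\<close> in direction
  \<open>h\<close>; convexity keeps the segment inside \<open>S\<close>. The remainder stays in
  Lagrange form, so that continuity of \<open>H\<close> can be used on it in limits.\<close>

lemma Taylor2_segment:
  assumes "twice_diff_on S f g H" "convex S" "q \<in> S" "q + h \<in> S"
  shows "\<exists>\<zeta>\<in>{0<..<1}. f (q + h) = f q + g q \<bullet> h + (h \<bullet> (H (q + \<zeta> *\<^sub>R h) *v h)) / 2"
proof -
  have S: "q + t *\<^sub>R h \<in> S" if "0 \<le> t" "t \<le> 1" for t
    using convexD_alt[OF assms(2,3,4) that] by (simp add: algebra_simps)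
  have 1: "((\<lambda>t. f (q + t *\<^sub>R h)) has_real_derivative (g (q + t *\<^sub>R h) \<bullet> h)) (at t)"
    if "0 \<le> t" "t \<le> 1" for t
    by (rule has_real_derivative_line[OF twice_diff_onD(1)[OF assms(1) S[OF that]]])
  have 2: "((\<lambda>t. g (q + t *\<^sub>R h) \<bullet> h) has_real_derivative (h \<bullet> (H (q + t *\<^sub>R h) *v h))) (at t)"
    if "0 \<le> t" "t \<le> 1" for t
    using has_real_derivative_line[OF has_derivative_inner_left[OF twice_diff_onD(2)[OF assms(1) S[OF that]], of h]]
    by (simp add: inner_commute)
  define D where "D m = (if m = 0 then (\<lambda>t. f (q + t *\<^sub>R h)) else if m = 1 then (\<lambda>t. g (q + t *\<^sub>R h) \<bullet> h)
     else (\<lambda>t. h \<bullet> (H (q + t *\<^sub>R h) *v h)))" for m :: nat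
  have "\<exists>t>0. t < 1 \<and> f (q + 1 *\<^sub>R h) = (\<Sum>m<2. D m 0 / fact m * 1 ^ m) + D 2 t / fact 2 * 1 ^ 2"
  proof (rule Maclaurin)
    show "\<forall>m t. m < 2 \<and> 0 \<le> t \<and> t \<le> 1 \<longrightarrow> (D m has_real_derivative D (Suc m) t) (at t)"
      using 1 2 by (auto simp: D_def less_2_cases_iff)
  qed (auto simp: D_def)
  then show ?thesis
    by (auto simp: D_def numeral_2_eq_2)
qed

lemma mvt_segment:
  assumes "\<And>y. y \<in> S \<Longrightarrow> (f has_derivative (\<lambda>h. g y \<bullet> h)) (at y)" "convex S" "q \<in> S" "q + h \<in> S"
  shows "\<exists>\<zeta>\<in>{0<..<1::real}. f (q + h) = f q + g (q + \<zeta> *\<^sub>R h) \<bullet> h"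
proof -
  have S: "q + t *\<^sub>R h \<in> S" if "0 \<le> t" "t \<le> 1" for t
    using convexD_alt[OF assms(2,3,4) that] by (simp add: algebra_simps)
  have 1: "((\<lambda>t. f (q + t *\<^sub>R h)) has_real_derivative (g (q + t *\<^sub>R h) \<bullet> h)) (at t)"
    if "0 \<le> t" "t \<le> 1" for t
    by (rule has_real_derivative_line[OF assms(1)[OF S[OF that]]])
  show ?thesis
    using MVT2[of 0 1 "\<lambda>t. f (q + t *\<^sub>R h)", OF _ 1] by (auto simp: algebra_simps)
qed

text \<open>The mean value theorem is used twice: in direction \<open>u\<close> for the increment
  \<open>f (y + v) - f y\<close> as a function of \<open>y\<close>, then in direction
  \<open>v\<close> for the component of the gradient along \<open>u\<close>.\<close>

lemma second_difference:
  assumes "twice_diff_on S f g H" "convex S" "x \<in> S" "x + u \<in> S" "x + v \<in> S" "x + u + v \<in> S"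
  shows "\<exists>a\<in>{0<..<1::real}. \<exists>b\<in>{0<..<1::real}.
    f (x + u + v) - f (x + u) - f (x + v) + f x = (H (x + a *\<^sub>R u + b *\<^sub>R v) *v v) \<bullet> u"
proof -
  define S' where "S' = {y. y \<in> S \<and> y + v \<in> S}"
  have conv: "convex S'"
  proof -
    have "S' = S \<inter> (+) (- v) ` S" by (force simp: S'_def image_iff)
    then show ?thesis using assms(2) convex_translation convex_Int by metis
  qed
  have "((\<lambda>y. f (y + v) - f y) has_derivative (\<lambda>h. (g (y + v) - g y) \<bullet> h)) (at y)" if "y \<in> S'" for y
  proof -
    have "((\<lambda>y. y + v) has_derivative (\<lambda>h. h)) (at y)" by (auto intro!: derivative_eq_intros)
    then have "((\<lambda>y. f (y + v)) has_derivative (\<lambda>h. g (y + v) \<bullet> h)) (at y)"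
      by (rule has_derivative_compose) (use that S'_def twice_diff_onD(1)[OF assms(1)] in blast)
    then show ?thesis
      unfolding inner_diff_left
      by (rule has_derivative_diff) (use that S'_def twice_diff_onD(1)[OF assms(1)] in blast)
  qed
  from mvt_segment[OF this conv, of x u] obtain a where a: "a \<in> {0<..<1::real}"
    and e: "f (x + u + v) - f (x + u) = f (x + v) - f x + (g (x + a *\<^sub>R u + v) - g (x + a *\<^sub>R u)) \<bullet> u"
    using assms by (auto simp: S'_def add_ac)
  have "x + a *\<^sub>R u \<in> S'"
    using convexD_alt[OF conv, of x "x + u" a] a assms by (auto simp: S'_def algebra_simps)
  then have 1: "x + a *\<^sub>R u \<in> S" "x + a *\<^sub>R u + v \<in> S" by (auto simp: S'_def)
  have "((\<lambda>y. u \<bullet> g y) has_derivative (\<lambda>h. (u v* H y) \<bullet> h)) (at y)" if "y \<in> S" for y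
    using has_derivative_inner_right[OF twice_diff_onD(2)[OF assms(1) that], of u]
    by (simp add: dot_lmul_matrix)
  from mvt_segment[OF this assms(2) 1] obtain b where b: "b \<in> {0<..<1::real}"
    "u \<bullet> g (x + a *\<^sub>R u + v) = u \<bullet> g (x + a *\<^sub>R u) + (u v* H (x + a *\<^sub>R u + b *\<^sub>R v)) \<bullet> v"
    by auto
  then have "(g (x + a *\<^sub>R u + v) - g (x + a *\<^sub>R u)) \<bullet> u = (H (x + a *\<^sub>R u + b *\<^sub>R v) *v v) \<bullet> u"
    unfolding dot_lmul_matrix inner_commute[of _ u] inner_diff_right by linarith
  with a b e show ?thesis
    by (intro bexI[of _ a] bexI[of _ b]) auto
qed

text \<open>The second difference over a parallelogram is unchanged when its two sides trade places,
  so its evaluations in the two orders agree.\<close>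

lemma second_derivative_swap_near:
  fixes x :: "real ^ 'n"
  assumes "twice_diff_on (ball x e) f g H" "e > 0"
  shows "\<exists>y\<in>ball x e. \<exists>z\<in>ball x e. (H y *v v) \<bullet> u = (H z *v u) \<bullet> v"
proof -
  \<comment> \<open>Scaling by \<open>t\<close> fits the whole parallelogram into the ball. Both
    sides of the final equation are bilinear, so the factors \<open>t\<close> cancel.\<close>
  define t where "t = e / (norm u + norm v + 1)"
  have "0 < norm u + norm v + 1" by (simp add: add_nonneg_pos)
  then have t: "t > 0" "t * (norm u + norm v) < e"
    using assms(2) by (simp_all add: t_def pos_divide_less_eq)
  define u' v' where "u' = t *\<^sub>R u" and "v' = t *\<^sub>R v"
  have "norm u' + norm v' < e" using t by (simp add: u'_def v'_def distrib_left)
  then have ball: "x + a *\<^sub>R u' + b *\<^sub>R v' \<in> ball x e" if "a \<in> {0..1}" "b \<in> {0..1}" for a b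
  proof -
    have "norm (a *\<^sub>R u' + b *\<^sub>R v') \<le> a * norm u' + b * norm v'"
      using that by (intro order_trans[OF norm_triangle_ineq]) simp
    also have "\<dots> \<le> 1 * norm u' + 1 * norm v'"
      using that by (intro add_mono mult_right_mono) auto
    finally have "norm (a *\<^sub>R u' + b *\<^sub>R v') < e" using \<open>norm u' + norm v' < e\<close> by simp
    moreover have "dist x (x + w) = norm w" for w by (simp add: dist_norm)
    ultimately show ?thesis by (simp only: mem_ball add.assoc)
  qed
  have c: "x \<in> ball x e" "x + u' \<in> ball x e" "x + v' \<in> ball x e" "x + u' + v' \<in> ball x e" "x + v' + u' \<in> ball x e"
    using ball[of 0 0] ball[of 1 0] ball[of 0 1] ball[of 1 1]
    by (simp_all only: scaleR_zero_left scaleR_one add_0_right atLeastAtMost_iff zero_le_one order_refl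
        simp_thms add.assoc add.commute[of v'])
  from second_difference[OF assms(1) convex_ball c(1-4)] obtain a b where
    ab: "a \<in> {0<..<1}" "b \<in> {0<..<1}" and
    1: "f (x + u' + v') - f (x + u') - f (x + v') + f x = (H (x + a *\<^sub>R u' + b *\<^sub>R v') *v v') \<bullet> u'" by (elim bexE)
  from second_difference[OF assms(1) convex_ball c(1,3,2,5)] obtain a' b' where
    ab': "a' \<in> {0<..<1}" "b' \<in> {0<..<1}" and
    2: "f (x + v' + u') - f (x + v') - f (x + u') + f x = (H (x + a' *\<^sub>R v' + b' *\<^sub>R u') *v u') \<bullet> v'" by (elim bexE)
  have "f (x + v' + u') = f (x + u' + v')" by (simp only: add.assoc add.commute[of u'])
  with 1 2 have "(H (x + a *\<^sub>R u' + b *\<^sub>R v') *v v') \<bullet> u' = (H (x + a' *\<^sub>R v' + b' *\<^sub>R u') *v u') \<bullet> v'"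
    by linarith
  then have eq: "(H (x + a *\<^sub>R u' + b *\<^sub>R v') *v v) \<bullet> u = (H (x + a' *\<^sub>R v' + b' *\<^sub>R u') *v u) \<bullet> v"
    using t(1) by (simp only: u'_def v'_def matrix_vector_mult_scaleR inner_scaleR_left inner_scaleR_right
       mult_cancel_left) simp
  have yb: "x + a *\<^sub>R u' + b *\<^sub>R v' \<in> ball x e"
    by (rule ball) (use ab in auto)
  have "x + b' *\<^sub>R u' + a' *\<^sub>R v' \<in> ball x e"
    by (rule ball) (use ab' in auto)
  then have zb: "x + a' *\<^sub>R v' + b' *\<^sub>R u' \<in> ball x e"
    by (simp only: add.assoc add.commute[of "a' *\<^sub>R v'"])
  show ?thesis by (intro bexI, rule eq, rule zb, rule yb)
qed

lemma tendsto_matrix_vector_mult [tendsto_intros]: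
  fixes A :: "'a \<Rightarrow> real ^ 'n ^ 'm"
  assumes "(A \<longlongrightarrow> L) F" "(v \<longlongrightarrow> w) F"
  shows "((\<lambda>x. A x *v v x) \<longlongrightarrow> L *v w) F"
  unfolding matrix_vector_mult_def by (intro tendsto_vec_lambda tendsto_sum tendsto_mult tendsto_vec_nth assms)

text \<open>The two evaluation points from \<open>second_derivative_swap_near\<close> are forced to
  \<open>x\<close> by shrinking balls, and continuity of \<open>H\<close> passes the equation to the
  limit.\<close>

lemma symmetric_second_derivative:
  fixes U :: "(real ^ 'n) set"
  assumes "twice_diff_on U f g H" "open U" "x \<in> U"
  shows "(H x *v v) \<bullet> u = (H x *v u) \<bullet> v"
proof -
  obtain e where e: "e > 0" "ball x e \<subseteq> U" using assms open_contains_ball by blast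
  define d where "d n = min e (inverse (real (Suc n)))" for n
  have d: "d n > 0" "d n \<le> e" "d n \<le> inverse (real (Suc n))" for n using e by (auto simp: d_def)
  have "twice_diff_on (ball x (d n)) f g H" for n
    using assms(1) by (rule twice_diff_on_subset) (use e(2) d(2)[of n] in auto)
  from second_derivative_swap_near[OF this d(1)]
  have "\<forall>n. \<exists>y z. y \<in> ball x (d n) \<and> z \<in> ball x (d n) \<and> (H y *v v) \<bullet> u = (H z *v u) \<bullet> v"
    by blast
  then obtain y z where yz: "y n \<in> ball x (d n)" "z n \<in> ball x (d n)"
    and eq: "(H (y n) *v v) \<bullet> u = (H (z n) *v u) \<bullet> v" for n by metis
  have lim: "w \<longlonglongrightarrow> x" if "\<And>n. w n \<in> ball x (d n)" for w
  proof (rule metric_tendsto_imp_tendsto[OF LIMSEQ_inverse_real_of_nat])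
    have "dist (w n) x \<le> dist (inverse (real (Suc n))) 0" for n
      using that[of n] d(3)[of n] by (simp add: dist_commute[of x])
    then show "\<forall>\<^sub>F n in sequentially. dist (w n) x \<le> dist (inverse (real (Suc n))) 0"
      by simp
  qed
  have H: "(\<lambda>n. H (w n)) \<longlonglongrightarrow> H x" if "\<And>n. w n \<in> ball x (d n)" for w
    using twice_diff_onD(3)[OF assms(1)] assms(2,3) lim[of w] that
    by (intro isCont_tendsto_compose[of _ H]) (auto simp: continuous_on_eq_continuous_at)
  have "(\<lambda>n. (H (y n) *v v) \<bullet> u) \<longlonglongrightarrow> (H x *v v) \<bullet> u"
    by (intro tendsto_intros H yz)
  moreover have "(\<lambda>n. (H (z n) *v u) \<bullet> v) \<longlonglongrightarrow> (H x *v u) \<bullet> v"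
    by (intro tendsto_intros H yz)
  ultimately show ?thesis unfolding eq by (rule LIMSEQ_unique)
qed

subsection \<open>Functions vanishing on the boundary\<close>

text \<open>A negative value would put \<open>q\<close> into the open set \<open>\<Omega>\<close>,
  which misses its frontier. A positive value would persist on a neighborhood of \<open>q\<close>
  that is disjoint from \<open>\<Omega>\<close>, contradicting that \<open>q\<close> is in the
  closure.\<close>

lemma local_defining_function_zero:
  assumes "local_defining_function \<sigma> \<Omega> U" "continuous_on U \<sigma>" "open \<Omega>" "q \<in> frontier \<Omega> \<inter> U"
  shows "\<sigma> q = 0"
proof -
  have U: "open U" "\<Omega> \<inter> U = {x \<in> U. \<sigma> x < 0}" using assms(1) by (auto simp: local_defining_function_def)
  have "q \<notin> \<Omega>" "q \<in> closure \<Omega>" using assms by (auto simp: frontier_def interior_open)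
  then have "\<not> \<sigma> q < 0" using U assms by auto
  moreover have "\<not> \<sigma> q > 0"
  proof
    assume "\<sigma> q > 0"
    have "open (U \<inter> \<sigma> -` {0<..})"
      using assms(2) U(1) by (intro continuous_open_preimage) auto
    moreover have "(U \<inter> \<sigma> -` {0<..}) \<inter> \<Omega> = {}" using U(2) by force
    ultimately have "(U \<inter> \<sigma> -` {0<..}) \<inter> closure \<Omega> = {}" by (simp add: open_Int_closure_eq_empty)
    then show False using assms \<open>q \<in> closure \<Omega>\<close> \<open>\<sigma> q > 0\<close> by auto
  qed
  ultimately show ?thesis by simp
qed

text \<open>The test vector is the component of \<open>w\<close> orthogonal to \<open>\<nu>\<close>,
  whose squared length is its product with \<open>w\<close>. The one-sided hypothesis covers both
  vanishing derivatives and the distance comparison below.\<close>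

lemma parallel_if_perp_le:
  fixes w \<nu> :: "'a :: real_inner"
  assumes "norm \<nu> = 1" "\<And>\<tau>. \<nu> \<bullet> \<tau> = 0 \<Longrightarrow> w \<bullet> \<tau> \<le> 0"
  shows "w = (w \<bullet> \<nu>) *\<^sub>R \<nu>"
proof -
  define \<tau> where "\<tau> = w - (w \<bullet> \<nu>) *\<^sub>R \<nu>"
  have "\<nu> \<bullet> \<nu> = 1" using assms(1) by (simp add: dot_square_norm)
  then have n: "\<nu> \<bullet> \<tau> = 0" by (simp add: \<tau>_def inner_diff_right inner_commute)
  have "\<tau> \<bullet> \<tau> = w \<bullet> \<tau> - (w \<bullet> \<nu>) * (\<nu> \<bullet> \<tau>)" by (simp add: \<tau>_def inner_diff_left)
  also have "\<dots> \<le> 0" using assms(2)[OF n] n by simp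
  finally have "\<tau> = 0" using inner_gt_zero_iff[of \<tau>] by linarith
  then show ?thesis by (simp add: \<tau>_def)
qed

text \<open>Only first-order data of \<open>\<sigma>\<close> at \<open>q\<close> and its sign on a
  ball are fixed here. They already yield frontier points approaching \<open>q\<close> along every
  tangent direction, which is how the boundary is accessed throughout.\<close>

locale boundary_point =
  fixes \<Omega> :: "(real ^ 'n) set" and \<sigma> :: "real ^ 'n \<Rightarrow> real" and q :: "real ^ 'n" and e :: real
    and \<nu> :: "real ^ 'n"
  assumes local_def: "local_defining_function \<sigma> \<Omega> (ball q e)" and e_pos: "e > 0"
    and q_frontier: "q \<in> frontier \<Omega>" and sigma_q: "\<sigma> q = 0"
    and deriv_q: "(\<sigma> has_derivative (\<lambda>h. \<nu> \<bullet> h)) (at q)" and norm_nu: "norm \<nu> = 1"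
begin

lemma nu_nu: "\<nu> \<bullet> \<nu> = 1"
  using norm_nu by (simp add: dot_square_norm)

lemma sign_along_line:
  assumes "\<nu> \<bullet> w > 0"
  shows "\<exists>d>0. \<forall>t. 0 < t \<and> t < d \<longrightarrow> \<sigma> (q + t *\<^sub>R w) > 0"
    and "\<exists>d>0. \<forall>t. 0 < t \<and> t < d \<longrightarrow> \<sigma> (q - t *\<^sub>R w) < 0"
proof -
  have "(\<sigma> has_derivative (\<lambda>h. \<nu> \<bullet> h)) (at (q + 0 *\<^sub>R w))" "(\<sigma> has_derivative (\<lambda>h. \<nu> \<bullet> h)) (at (q + 0 *\<^sub>R (- w)))"
    using deriv_q by simp_all
  from this[THEN has_real_derivative_line]
  have d: "((\<lambda>t. \<sigma> (q + t *\<^sub>R w)) has_real_derivative \<nu> \<bullet> w) (at 0)"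
     "((\<lambda>t. \<sigma> (q + t *\<^sub>R (- w))) has_real_derivative \<nu> \<bullet> (- w)) (at 0)" by auto
  from DERIV_pos_inc_right[OF d(1)] assms sigma_q
  show "\<exists>d>0. \<forall>t. 0 < t \<and> t < d \<longrightarrow> \<sigma> (q + t *\<^sub>R w) > 0" by auto
  from DERIV_neg_dec_right[OF d(2)] assms sigma_q
  show "\<exists>d>0. \<forall>t. 0 < t \<and> t < d \<longrightarrow> \<sigma> (q - t *\<^sub>R w) < 0" by auto
qed

text \<open>Tilting \<open>\<tau>\<close> by \<open>\<epsilon>\<close> towards either normal side
  gives, for small \<open>t\<close>, one point in \<open>\<Omega>\<close> and one outside. The
  segment between them is connected and so meets the frontier.\<close>

lemma frontier_point_near_tangent:
  assumes "\<nu> \<bullet> \<tau> = 0" "\<epsilon> > 0"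
  shows "\<exists>t v. 0 < t \<and> t < \<epsilon> \<and> norm (v - \<tau>) \<le> \<epsilon> \<and> q + t *\<^sub>R v \<in> frontier \<Omega> \<inter> ball q e"
proof -
  have p: "\<nu> \<bullet> (\<tau> + \<epsilon> *\<^sub>R \<nu>) > 0" "\<nu> \<bullet> (\<epsilon> *\<^sub>R \<nu> - \<tau>) > 0"
    using assms nu_nu by (simp_all add: inner_add_right inner_diff_right)
  obtain d1 where d1: "d1 > 0" "\<And>t. 0 < t \<Longrightarrow> t < d1 \<Longrightarrow> \<sigma> (q + t *\<^sub>R (\<tau> + \<epsilon> *\<^sub>R \<nu>)) > 0"
    using sign_along_line(1)[OF p(1)] by auto
  obtain d2 where d2: "d2 > 0" "\<And>t. 0 < t \<Longrightarrow> t < d2 \<Longrightarrow> \<sigma> (q - t *\<^sub>R (\<epsilon> *\<^sub>R \<nu> - \<tau>)) < 0"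
    using sign_along_line(2)[OF p(2)] by auto
  \<comment> \<open>\<open>M\<close> exceeds the length of every
    \<open>\<tau> + k *\<^sub>R \<nu>\<close> with \<open>k\<close> between
    \<open>- \<epsilon>\<close> and \<open>\<epsilon>\<close>, so \<open>t * M < e\<close> keeps all
    these points in the ball.\<close>
  define M where "M = norm \<tau> + \<epsilon> + 1"
  have M: "M > 0" using assms by (simp add: M_def add_nonneg_pos)
  define t where "t = min (min (d1 / 2) (d2 / 2)) (min (\<epsilon> / 2) (e / (2 * M)))"
  have t: "0 < t" "t < d1" "t < d2" "t < \<epsilon>" "t \<le> e / (2 * M)"
    using d1 d2 assms e_pos M by (auto simp: t_def min_def)
  then have tM: "t * M < e" using M e_pos by (simp add: field_simps)
  have ball: "q + t *\<^sub>R (\<tau> + k *\<^sub>R \<nu>) \<in> ball q e" if "\<bar>k\<bar> \<le> \<epsilon>" for k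
  proof -
    have "norm (\<tau> + k *\<^sub>R \<nu>) \<le> norm \<tau> + \<bar>k\<bar>"
      using norm_triangle_ineq[of \<tau> "k *\<^sub>R \<nu>"] norm_nu by simp
    then have "norm (t *\<^sub>R (\<tau> + k *\<^sub>R \<nu>)) \<le> t * M"
      using t that by (simp add: M_def)
    then show ?thesis using tM by (simp add: dist_norm)
  qed
  define a b where "a = q + t *\<^sub>R (\<tau> + (- \<epsilon>) *\<^sub>R \<nu>)" and "b = q + t *\<^sub>R (\<tau> + \<epsilon> *\<^sub>R \<nu>)"
  have \<Omega>: "\<Omega> \<inter> ball q e = {x \<in> ball q e. \<sigma> x < 0}"
    using local_def by (simp add: local_defining_function_def)
  have ab: "a \<in> ball q e" "b \<in> ball q e" using ball[of "- \<epsilon>"] ball[of \<epsilon>] assms by (auto simp: a_def b_def)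
  have "a = q - t *\<^sub>R (\<epsilon> *\<^sub>R \<nu> - \<tau>)" by (simp add: a_def algebra_simps)
  then have "\<sigma> a < 0" "\<sigma> b > 0" using d1(2)[of t] d2(2)[of t] t by (auto simp: b_def)
  then have "a \<in> \<Omega>" "b \<notin> \<Omega>"
    using ab set_eq_iff[THEN iffD1, OF \<Omega>, rule_format, of a] set_eq_iff[THEN iffD1, OF \<Omega>, rule_format, of b]
    by auto
  then have "closed_segment a b \<inter> frontier \<Omega> \<noteq> {}"
    by (intro connected_Int_frontier) auto
  then obtain z s where z: "z \<in> frontier \<Omega>" "z = (1 - s) *\<^sub>R a + s *\<^sub>R b" "0 \<le> s" "s \<le> 1"
    by (auto simp: closed_segment_def)
  \<comment> \<open>The crossing at parameter \<open>s\<close> has normal offset \<open>k\<close>,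
    which runs from \<open>- \<epsilon>\<close> to \<open>\<epsilon>\<close> along the
    segment.\<close>
  define k where "k = (2 * s - 1) * \<epsilon>"
  have k: "\<bar>k\<bar> \<le> \<epsilon>"
    using mult_right_mono[of "\<bar>2 * s - 1\<bar>" 1 \<epsilon>] z assms by (simp add: k_def abs_mult)
  have "z = q + t *\<^sub>R (\<tau> + k *\<^sub>R \<nu>)"
    unfolding z(2) a_def b_def k_def by (simp add: algebra_simps vec_eq_iff)
  with z(1) ball[OF k] k t norm_nu show ?thesis
    by (intro exI[of _ t] exI[of _ "\<tau> + k *\<^sub>R \<nu>"]) auto
qed

lemma frontier_tangent_sequence:
  assumes "\<nu> \<bullet> \<tau> = 0"
  obtains t v where "\<And>n. 0 < t n" "t \<longlonglongrightarrow> 0" "v \<longlonglongrightarrow> \<tau>" "\<And>n. q + t n *\<^sub>R v n \<in> frontier \<Omega> \<inter> ball q e"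
proof -
  have "\<forall>n. \<exists>t v. 0 < t \<and> t < inverse (real (Suc n)) \<and> norm (v - \<tau>) \<le> inverse (real (Suc n)) \<and> q + t *\<^sub>R v \<in> frontier \<Omega> \<inter> ball q e"
    using frontier_point_near_tangent[OF assms] by simp
  then obtain t v where tv: "\<And>n. 0 < t n" "\<And>n. t n < inverse (real (Suc n))"
    "\<And>n. norm (v n - \<tau>) \<le> inverse (real (Suc n))" "\<And>n. q + t n *\<^sub>R v n \<in> frontier \<Omega> \<inter> ball q e"
    by metis
  have "t \<longlonglongrightarrow> 0"
    by (rule tendsto_sandwich[OF _ _ tendsto_const LIMSEQ_inverse_real_of_nat])
      (use tv in \<open>auto intro!: always_eventually less_imp_le\<close>)
  moreover have "v \<longlonglongrightarrow> \<tau>"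
    by (rule metric_tendsto_imp_tendsto[OF LIMSEQ_inverse_real_of_nat])
      (use tv(3) in \<open>auto intro!: always_eventually simp: dist_norm\<close>)
  ultimately show ?thesis using that tv by blast
qed

text \<open>Both claims come from the second-order Taylor expansion of \<open>G\<close> at \<open>q\<close> along boundary points
  \<open>q + t\<^sub>n v\<^sub>n\<close> with \<open>v\<^sub>n \<rightarrow> \<tau>\<close>; no parametrisation of the boundary is needed.\<close>

lemma vanishing_on_frontier:
  assumes G: "twice_diff_on (ball q e) G g H" and zero: "\<And>y. y \<in> frontier \<Omega> \<inter> ball q e \<Longrightarrow> G y = 0"
    and "\<nu> \<bullet> \<tau> = 0"
  shows "g q \<bullet> \<tau> = 0" and "g q = 0 \<Longrightarrow> \<tau> \<bullet> (H q *v \<tau>) = 0"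
proof -
  obtain t v where t: "\<And>n. 0 < t n" "t \<longlonglongrightarrow> 0" and v: "v \<longlonglongrightarrow> \<tau>"
    and fr: "\<And>n. q + t n *\<^sub>R v n \<in> frontier \<Omega> \<inter> ball q e"
    using frontier_tangent_sequence[OF assms(3)] by metis
  have q: "q \<in> ball q e" "G q = 0" using e_pos zero q_frontier by auto
  have "\<forall>n. \<exists>\<zeta>\<in>{0<..<1}. t n * (g q \<bullet> v n + t n * (v n \<bullet> (H (q + \<zeta> *\<^sub>R t n *\<^sub>R v n) *v v n)) / 2) = 0"
  proof
    fix n
    from Taylor2_segment[OF G convex_ball q(1), of "t n *\<^sub>R v n"] zero[OF fr[of n]] fr[of n] q(2)
    obtain \<zeta> where "\<zeta> \<in> {0<..<1}" and
      "0 = g q \<bullet> (t n *\<^sub>R v n) + ((t n *\<^sub>R v n) \<bullet> (H (q + \<zeta> *\<^sub>R t n *\<^sub>R v n) *v (t n *\<^sub>R v n))) / 2"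
      by auto
    then show "\<exists>\<zeta>\<in>{0<..<1}. t n * (g q \<bullet> v n + t n * (v n \<bullet> (H (q + \<zeta> *\<^sub>R t n *\<^sub>R v n) *v v n)) / 2) = 0"
      by (intro bexI[of _ \<zeta>]) (simp_all add: matrix_vector_mult_scaleR distrib_left)
  qed
  \<comment> \<open>Cancelling \<open>t n\<close> leaves the gradient term plus a remainder that
    still carries a factor \<open>t n\<close> and so disappears in the limit.\<close>
  then have "\<forall>n. \<exists>\<zeta>\<in>{0<..<1}. g q \<bullet> v n + t n * (v n \<bullet> (H (q + \<zeta> *\<^sub>R t n *\<^sub>R v n) *v v n)) / 2 = 0"
    using t(1) by (metis less_irrefl mult_eq_0_iff)
  then obtain \<zeta> where \<zeta>: "\<And>n. \<zeta> n \<in> {0<..<1}"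
    and eq: "\<And>n. g q \<bullet> v n + t n * (v n \<bullet> (H (q + \<zeta> n *\<^sub>R t n *\<^sub>R v n) *v v n)) / 2 = 0"
    by metis
  have "(\<lambda>n. \<zeta> n * t n) \<longlonglongrightarrow> 0"
    by (rule tendsto_sandwich[OF _ _ tendsto_const t(2)])
      (use \<zeta> t(1) in \<open>auto intro!: always_eventually mult_left_le_one_le simp: less_imp_le mult_nonneg_nonneg\<close>)
  then have "(\<lambda>n. q + (\<zeta> n * t n) *\<^sub>R v n) \<longlonglongrightarrow> q + 0 *\<^sub>R \<tau>"
    by (intro tendsto_intros v)
  then have "(\<lambda>n. q + \<zeta> n *\<^sub>R t n *\<^sub>R v n) \<longlonglongrightarrow> q" by simp
  moreover have "isCont H q"
    using twice_diff_onD(3)[OF G] q(1) by (simp add: continuous_on_eq_continuous_at del: mem_ball)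
  ultimately have Hlim: "(\<lambda>n. H (q + \<zeta> n *\<^sub>R t n *\<^sub>R v n)) \<longlonglongrightarrow> H q"
    by (intro isCont_tendsto_compose[of _ H])
  then have lim: "(\<lambda>n. v n \<bullet> (H (q + \<zeta> n *\<^sub>R t n *\<^sub>R v n) *v v n)) \<longlonglongrightarrow> \<tau> \<bullet> (H q *v \<tau>)"
    by (intro tendsto_intros v)
  then have "(\<lambda>n. g q \<bullet> v n + t n * (v n \<bullet> (H (q + \<zeta> n *\<^sub>R t n *\<^sub>R v n) *v v n)) / 2) \<longlonglongrightarrow> g q \<bullet> \<tau> + 0 * (\<tau> \<bullet> (H q *v \<tau>)) / 2"
    by (intro tendsto_add tendsto_inner tendsto_const v tendsto_divide tendsto_mult t lim) simp
  then show "g q \<bullet> \<tau> = 0"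
    unfolding eq by (simp add: LIMSEQ_const_iff)
  show "\<tau> \<bullet> (H q *v \<tau>) = 0" if "g q = 0"
  proof -
    \<comment> \<open>Without the gradient term the second factor \<open>t n\<close> cancels as
      well, and the quadratic form survives in the limit.\<close>
    have "v n \<bullet> (H (q + \<zeta> n *\<^sub>R t n *\<^sub>R v n) *v v n) = 0" for n
      using eq[of n] t(1)[of n] that by simp
    with lim show ?thesis by (simp add: LIMSEQ_const_iff)
  qed
qed

lemma vanishing_on_frontier_gradient:
  assumes "twice_diff_on (ball q e) G g H" "\<And>y. y \<in> frontier \<Omega> \<inter> ball q e \<Longrightarrow> G y = 0"
  shows "g q = (g q \<bullet> \<nu>) *\<^sub>R \<nu>"
  using parallel_if_perp_le[OF norm_nu] vanishing_on_frontier(1)[OF assms] by simp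

text \<open>Comparing squared distances from \<open>x\<close> to \<open>q\<close> and to a frontier
  point \<open>q + t v\<close> bounds twice the product of \<open>x - q\<close> with
  \<open>v\<close> by \<open>t |v|^2\<close>. As these points approach \<open>q\<close> along a
  tangent direction, the product with that direction becomes nonpositive in the limit.\<close>

lemma nearest_point_normal:
  assumes "\<And>y. y \<in> frontier \<Omega> \<Longrightarrow> dist x q \<le> dist x y"
  shows "x - q = ((x - q) \<bullet> \<nu>) *\<^sub>R \<nu>"
proof (rule parallel_if_perp_le[OF norm_nu])
  fix \<tau> assume "\<nu> \<bullet> \<tau> = 0"
  then obtain t v where t: "\<And>n. 0 < t n" "t \<longlonglongrightarrow> 0" and v: "v \<longlonglongrightarrow> \<tau>"
    and fr: "\<And>n. q + t n *\<^sub>R v n \<in> frontier \<Omega> \<inter> ball q e"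
    using frontier_tangent_sequence by metis
  have "(x - q) \<bullet> v n \<le> t n * (v n \<bullet> v n) / 2" for n
  proof -
    have "norm (x - q) \<le> norm ((x - q) - t n *\<^sub>R v n)"
      using assms[of "q + t n *\<^sub>R v n"] fr[of n] by (simp add: dist_norm diff_diff_eq)
    then have "(x - q) \<bullet> (x - q) \<le> ((x - q) - t n *\<^sub>R v n) \<bullet> ((x - q) - t n *\<^sub>R v n)"
      by (simp add: norm_le)
    then have "t n * (2 * ((x - q) \<bullet> v n)) \<le> t n * (t n * (v n \<bullet> v n))"
      by (simp add: inner_diff_left inner_diff_right inner_commute algebra_simps)
    then show ?thesis using t(1)[of n] by simp
  qed
  then have le: "\<exists>N. \<forall>n\<ge>N. (x - q) \<bullet> v n \<le> t n * (v n \<bullet> v n) / 2" by blast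
  have l1: "(\<lambda>n. (x - q) \<bullet> v n) \<longlonglongrightarrow> (x - q) \<bullet> \<tau>" by (intro tendsto_intros v)
  have l2: "(\<lambda>n. t n * (v n \<bullet> v n) / 2) \<longlonglongrightarrow> 0 * (\<tau> \<bullet> \<tau>) / 2" by (intro tendsto_intros v t) simp
  show "(x - q) \<bullet> \<tau> \<le> 0" using LIMSEQ_le[OF l1 l2 le] by simp
qed

text \<open>At \<open>q\<close> the gradient of \<open>r\<close> is \<open>c \<nu>\<close> with \<open>c > 0\<close>; apply the second-order claim to \<open>r - c \<sigma>\<close>.\<close>

lemma hessian_nonneg_on_tangent_space:
  assumes S: "twice_diff_on (ball q e) \<sigma> g H"
    and zero: "\<And>y. y \<in> frontier \<Omega> \<inter> ball q e \<Longrightarrow> \<sigma> y = 0"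
    and r: "defining_function r \<Omega>"
    and conv: "\<forall>\<tau> \<in> tangent_space r q. 0 \<le> hessian_form r q \<tau>" and \<tau>: "\<nu> \<bullet> \<tau> = 0"
  shows "0 \<le> \<tau> \<bullet> (H q *v \<tau>)"
proof -
  have q: "q \<in> ball q e" using e_pos by simp
  have g: "g q = \<nu>"
    using grad_eq[OF twice_diff_onD(1)[OF S q]] grad_eq[OF deriv_q] by simp
  have sm: "smooth_on UNIV r" and \<Omega>: "\<Omega> = {x. r x < 0}" "{x. r x = 0} = frontier \<Omega>"
    and nz: "grad r q \<noteq> 0"
    using r q_frontier by (auto simp: defining_function_def)
  have R: "twice_diff_on UNIV r (grad r) (hessian r)" by (rule smooth_on_twice_diff_on[OF sm])
  then have R': "twice_diff_on (ball q e) r (grad r) (hessian r)" by (rule twice_diff_on_subset) simp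
  define c where "c = grad r q \<bullet> \<nu>"
  have gr: "grad r q = c *\<^sub>R \<nu>"
    unfolding c_def by (rule vanishing_on_frontier_gradient[OF R']) (use \<Omega> in auto)
  \<comment> \<open>For negative \<open>c\<close>, the function \<open>r\<close> would increase from
    \<open>q\<close> in the direction \<open>- \<nu>\<close>. But \<open>\<sigma>\<close> is
    negative there, so these points lie in \<open>\<Omega>\<close>, where \<open>r\<close> is
    negative.\<close>
  have "c \<ge> 0"
  proof (rule ccontr)
    assume "\<not> c \<ge> 0"
    have "(r has_derivative (\<lambda>h. grad r q \<bullet> h)) (at (q + 0 *\<^sub>R (- \<nu>)))"
      using twice_diff_onD(1)[OF R] by simp
    from has_real_derivative_line[OF this]
    have "((\<lambda>t. r (q + t *\<^sub>R (- \<nu>))) has_real_derivative - c) (at 0)" by (simp add: c_def)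
    from DERIV_pos_inc_right[OF this] \<open>\<not> c \<ge> 0\<close>
    obtain d where d: "d > 0" "\<And>t. 0 < t \<Longrightarrow> t < d \<Longrightarrow> r q < r (q - t *\<^sub>R \<nu>)" by auto
    obtain d' where d': "d' > 0" "\<And>t. 0 < t \<Longrightarrow> t < d' \<Longrightarrow> \<sigma> (q - t *\<^sub>R \<nu>) < 0"
      using sign_along_line(2)[of \<nu>] nu_nu by auto
    define t where "t = min (min (d / 2) (d' / 2)) (e / 2)"
    have t: "0 < t" "t < d" "t < d'" "t < e" using d d' e_pos by (auto simp: t_def)
    have "q - t *\<^sub>R \<nu> \<in> ball q e" using t norm_nu by (simp add: dist_norm)
    then have "q - t *\<^sub>R \<nu> \<in> \<Omega>" using d'(2) t local_def by (auto simp: local_defining_function_def)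
    moreover have "r q = 0" using q_frontier \<Omega> by auto
    ultimately show False using d(2) t \<Omega> by force
  qed
  with nz gr have c: "c > 0" by (cases "c = 0") auto
  have F: "twice_diff_on (ball q e) (\<lambda>x. r x + (- c) * \<sigma> x) (\<lambda>x. grad r x + (- c) *\<^sub>R g x)
      (\<lambda>x. hessian r x + (- c) *\<^sub>R H x)"
    by (intro twice_diff_on_add twice_diff_on_cmult R' S)
  have "\<tau> \<bullet> ((hessian r q + (- c) *\<^sub>R H q) *v \<tau>) = 0"
    by (rule vanishing_on_frontier(2)[OF F]) (use zero \<Omega> \<tau> gr g in auto)
  then have "\<tau> \<bullet> (hessian r q *v \<tau>) = c * (\<tau> \<bullet> (H q *v \<tau>))"
    by (simp add: matrix_vector_mult_add_rdistrib scaleR_matrix_vector_mult inner_add_right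
        del: scaleR_minus_left) 
  moreover have "\<tau> \<in> tangent_space r q" using \<tau> gr by (simp add: tangent_space_def)
  then have "0 \<le> \<tau> \<bullet> (hessian r q *v \<tau>)"
    using bspec[OF conv, of \<tau>] hessian_form_eq[OF R, of q \<tau>] by simp
  ultimately show ?thesis using c by (simp add: zero_le_mult_iff)
qed

text \<open>The second-order claim is applied to \<open>F = |\<nabla>\<sigma>|\<^sup>2 - 1 - c \<sigma>\<close>, where \<open>c\<close> is chosen such that \<open>\<nabla>F(q) = 0\<close>.\<close>

lemma third_derivative_identity:
  assumes S: "smooth_on (ball q e) \<sigma>"
    and zero: "\<And>y. y \<in> frontier \<Omega> \<inter> ball q e \<Longrightarrow> \<sigma> y = 0"
    and unit: "\<And>y. y \<in> frontier \<Omega> \<inter> ball q e \<Longrightarrow> norm (grad \<sigma> y) = 1"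
    and \<tau>: "\<nu> \<bullet> \<tau> = 0"
  defines "A \<equiv> hessian \<sigma> q"
  shows "\<nu> \<bullet> (A *v \<tau>) = 0"
    and "(\<Sum>i\<in>UNIV. \<nu> $ i * (\<tau> \<bullet> (hessian (partial_deriv i \<sigma>) q *v \<tau>)))
       = (\<nu> \<bullet> (A *v \<nu>)) * (\<tau> \<bullet> (A *v \<tau>)) - (norm (A *v \<tau>))\<^sup>2"
proof -
  define c where "c = 2 * (\<nu> \<bullet> (A *v \<nu>))"
  let ?\<sigma> = "\<lambda>i. partial_deriv i \<sigma>"
  \<comment> \<open>The doubled summands and the \<open>+ 0\<close> keep the literal shape that the
    sum and product rules produce, so these rules prove \<open>F\<close> directly.\<close>
  define gF where "gF x = (\<Sum>i\<in>UNIV. ?\<sigma> i x *\<^sub>R grad (?\<sigma> i) x + ?\<sigma> i x *\<^sub>R grad (?\<sigma> i) x) + ((- c) *\<^sub>R grad \<sigma> x + 0)" for x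
  define HF where "HF x = (\<Sum>i\<in>UNIV. ?\<sigma> i x *\<^sub>R hessian (?\<sigma> i) x + ?\<sigma> i x *\<^sub>R hessian (?\<sigma> i) x
      + outer (grad (?\<sigma> i) x) (grad (?\<sigma> i) x) + outer (grad (?\<sigma> i) x) (grad (?\<sigma> i) x)) + ((- c) *\<^sub>R hessian \<sigma> x + 0)" for x
  have F: "twice_diff_on (ball q e) (\<lambda>x. (\<Sum>i\<in>UNIV. ?\<sigma> i x * ?\<sigma> i x) + ((- c) * \<sigma> x + (- 1))) gF HF"
    unfolding gF_def[abs_def] HF_def[abs_def]
    by (intro twice_diff_on_add twice_diff_on_cmult twice_diff_on_sum twice_diff_on_mult twice_diff_on_const
        smooth_on_twice_diff_on smooth_on_partial_deriv S)
  have vanish: "(\<Sum>i\<in>UNIV. ?\<sigma> i y * ?\<sigma> i y) + ((- c) * \<sigma> y + (- 1)) = 0" if "y \<in> frontier \<Omega> \<inter> ball q e" for y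
  proof -
    have "(\<Sum>i\<in>UNIV. ?\<sigma> i y * ?\<sigma> i y) = grad \<sigma> y \<bullet> grad \<sigma> y" by (simp add: inner_vec_def grad_def)
    also have "\<dots> = 1" using unit[OF that] by (simp add: dot_square_norm)
    finally show ?thesis using zero[OF that] by simp
  qed
  have g: "grad \<sigma> q = \<nu>" by (rule grad_eq[OF deriv_q])
  then have \<nu>i: "?\<sigma> i q = \<nu> $ i" for i by (auto simp: grad_def vec_eq_iff)
  have Ai: "grad (?\<sigma> i) q \<bullet> h = (A *v h) $ i" for i h
    by (simp add: A_def hessian_def matrix_vector_mul_component)
  have gFh: "gF q \<bullet> h = 2 * (\<nu> \<bullet> (A *v h)) - c * (\<nu> \<bullet> h)" for h
    unfolding gF_def inner_add_left inner_sum_left inner_scaleR_left Ai \<nu>i g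
    by (simp add: inner_vec_def[of \<nu> "A *v h"] sum_distrib_left)
  from vanishing_on_frontier(1)[OF F vanish \<tau>]
  show 1: "\<nu> \<bullet> (A *v \<tau>) = 0" using \<tau> by (simp add: gFh)
  have "gF q = (gF q \<bullet> \<nu>) *\<^sub>R \<nu>" by (rule vanishing_on_frontier_gradient[OF F vanish])
  \<comment> \<open>The tangential part of the gradient is already gone; the value of
    \<open>c\<close> cancels the normal part.\<close>
  also have "gF q \<bullet> \<nu> = 0" by (simp add: gFh c_def nu_nu)
  finally have "gF q = 0" by simp
  have outer: "\<tau> \<bullet> (outer (grad (?\<sigma> i) q) (grad (?\<sigma> i) q) *v \<tau>) = (A *v \<tau>) $ i * (A *v \<tau>) $ i" for i
    by (simp add: outer_mult_vec Ai inner_commute[of \<tau>])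
  have norm: "(\<Sum>i\<in>UNIV. (A *v \<tau>) $ i * (A *v \<tau>) $ i) = (norm (A *v \<tau>))\<^sup>2"
    by (simp add: power2_norm_eq_inner inner_vec_def)
  have sum: "(\<Sum>i\<in>UNIV. X i) *v \<tau> = (\<Sum>i\<in>UNIV. X i *v \<tau>)" for X :: "'n \<Rightarrow> real ^ 'n ^ 'n"
    by (simp add: vec_eq_iff matrix_vector_mult_def sum_distrib_right) (auto intro: sum.swap)
  have "2 * (\<Sum>i\<in>UNIV. \<nu> $ i * (\<tau> \<bullet> (hessian (?\<sigma> i) q *v \<tau>))) + 2 * (norm (A *v \<tau>))\<^sup>2 - c * (\<tau> \<bullet> (A *v \<tau>))
     = \<tau> \<bullet> (HF q *v \<tau>)"
    unfolding HF_def matrix_vector_mult_add_rdistrib sum scaleR_matrix_vector_mult inner_add_right inner_sum_right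
      inner_scaleR_right sum.distrib \<nu>i A_def[symmetric] outer norm by simp
  also have "\<dots> = 0" by (rule vanishing_on_frontier(2)[OF F vanish \<tau> \<open>gF q = 0\<close>])
  finally show "(\<Sum>i\<in>UNIV. \<nu> $ i * (\<tau> \<bullet> (hessian (?\<sigma> i) q *v \<tau>)))
       = (\<nu> \<bullet> (A *v \<nu>)) * (\<tau> \<bullet> (A *v \<tau>)) - (norm (A *v \<tau>))\<^sup>2"
    by (simp add: c_def)
qed

end

text \<open>Positivity is tested on \<open>\<tau> - (1/K) A\<tau>\<close>.\<close>

lemma psd_norm_le:
  fixes A :: "real ^ 'n ^ 'n"
  assumes sym: "\<And>u v. (A *v v) \<bullet> u = (A *v u) \<bullet> v"
    and psd: "\<And>w. w \<in> T \<Longrightarrow> 0 \<le> w \<bullet> (A *v w)" and T: "subspace T" "\<tau> \<in> T" "A *v \<tau> \<in> T"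
    and K: "K > 0" "\<And>w. w \<bullet> (A *v w) \<le> K * (norm w)\<^sup>2"
  shows "(norm (A *v \<tau>))\<^sup>2 \<le> K * (\<tau> \<bullet> (A *v \<tau>))"
proof -
  define w a where "w = A *v \<tau>" and "a = 1 / K"
  have a: "a > 0" "a * K = 1" using K(1) by (simp_all add: a_def)
  have "\<tau> - a *\<^sub>R w \<in> T" using T by (simp add: w_def subspace_diff subspace_scale)
  from psd[OF this] have "0 \<le> \<tau> \<bullet> (A *v \<tau>) - 2 * (a * (w \<bullet> w)) + a * (a * (w \<bullet> (A *v w)))"
    using sym[of w \<tau>] by (simp add: w_def[symmetric] inner_diff_left inner_diff_right matrix_vector_mult_diff_distrib
        matrix_vector_mult_scaleR inner_commute algebra_simps)
  \<comment> \<open>With \<open>a = 1 / K\<close> the term quadratic in \<open>a\<close> takes back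
    at most half of the cross term, so \<open>a |w|^2\<close> remains.\<close>
  moreover have "a * (w \<bullet> (A *v w)) \<le> a * (K * (w \<bullet> w))"
    using K(2)[of w] a(1) by (simp add: power2_norm_eq_inner)
  then have "a * (w \<bullet> (A *v w)) \<le> w \<bullet> w" using a(2) by (simp flip: mult.assoc)
  then have "a * (a * (w \<bullet> (A *v w))) \<le> a * (w \<bullet> w)" using a(1) by simp
  ultimately have "a * (w \<bullet> w) \<le> \<tau> \<bullet> (A *v \<tau>)" by linarith
  then have "K * (a * (w \<bullet> w)) \<le> K * (\<tau> \<bullet> (A *v \<tau>))" using K(1) by simp
  moreover have "K * (a * (w \<bullet> w)) = w \<bullet> w" using a(2) by (simp flip: mult.assoc add: mult.commute)
  ultimately show ?thesis unfolding w_def power2_norm_eq_inner by linarith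
qed

subsection \<open>Uniform estimates\<close>

text \<open>The norm of a matrix is the Euclidean norm of its row norms, so Cauchy-Schwarz row by
  row suffices.\<close>

lemma norm_matrix_vector_mult_le: "norm (A *v x) \<le> norm A * norm x" for A :: "real ^ 'n ^ 'm"
proof -
  have "L2_set (\<lambda>k. norm ((A *v x) $ k)) UNIV \<le> L2_set (\<lambda>k. norm (A $ k) * norm x) UNIV"
    by (intro L2_set_mono) (auto simp: matrix_vector_mul_component Cauchy_Schwarz_ineq2)
  also have "\<dots> = norm A * norm x"
    by (simp add: norm_vec_def[of A] L2_set_left_distrib)
  finally show ?thesis by (simp add: norm_vec_def[of "A *v x"])
qed

lemma smooth_on_derivative_bounds:
  assumes "smooth_on U f" "compact S" "S \<subseteq> U"
  shows "\<exists>K\<ge>0. \<forall>x\<in>S. norm (grad f x) \<le> K \<and> (\<forall>v. norm (hessian f x *v v) \<le> K * norm v)"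
proof -
  have T: "twice_diff_on S f (grad f) (hessian f)"
    using twice_diff_on_subset[OF smooth_on_twice_diff_on[OF assms(1)] assms(3)] .
  obtain K1 where K1: "\<And>x. x \<in> S \<Longrightarrow> norm (grad f x) \<le> K1"
    using compact_imp_bounded[OF compact_continuous_image[OF twice_diff_on_continuous(2)[OF T] assms(2)]]
    by (auto simp: bounded_iff)
  obtain K2 where K2: "\<And>x. x \<in> S \<Longrightarrow> norm (hessian f x) \<le> K2"
    using compact_imp_bounded[OF compact_continuous_image[OF twice_diff_onD(3)[OF T] assms(2)]]
    by (auto simp: bounded_iff)
  define K where "K = max 0 (max K1 K2)"
  have "norm (hessian f x *v v) \<le> K * norm v" if "x \<in> S" for x v
  proof -
    have "norm (hessian f x) \<le> K" using K2[OF that] by (simp add: K_def)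
    then show ?thesis
      using norm_matrix_vector_mult_le[of "hessian f x" v] mult_right_mono[of "norm (hessian f x)" K "norm v"]
      by simp
  qed
  then show ?thesis using K1 by (intro exI[of _ K]) (force simp: K_def)
qed

text \<open>Compactness bounds gradient and Hessian uniformly, and convexity keeps the intermediate
  points of the mean value and Taylor formulas where these bounds hold.\<close>

lemma smooth_on_Taylor_bounds:
  fixes f :: "real ^ 'n \<Rightarrow> real"
  assumes "smooth_on U f" "compact S" "convex S" "S \<subseteq> U"
  shows "\<exists>K\<ge>0. \<forall>q\<in>S. \<forall>x\<in>S. \<bar>f x - f q\<bar> \<le> K * norm (x - q) \<and>
      \<bar>f x - f q - grad f q \<bullet> (x - q)\<bar> \<le> K * (norm (x - q))\<^sup>2"
proof -
  have T: "twice_diff_on S f (grad f) (hessian f)"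
    using twice_diff_on_subset[OF smooth_on_twice_diff_on[OF assms(1)] assms(4)] .
  obtain K where K: "K \<ge> 0" "\<And>x. x \<in> S \<Longrightarrow> norm (grad f x) \<le> K"
    "\<And>x v. x \<in> S \<Longrightarrow> norm (hessian f x *v v) \<le> K * norm v"
    using smooth_on_derivative_bounds[OF assms(1,2,4)] by auto
  have seg: "q + \<zeta> *\<^sub>R (x - q) \<in> S" if "q \<in> S" "x \<in> S" "\<zeta> \<in> {0<..<1}" for q x \<zeta>
    using convexD_alt[OF assms(3) that(1,2), of \<zeta>] that(3) by (simp add: algebra_simps)
  have "\<bar>f x - f q\<bar> \<le> K * norm (x - q)" if qx: "q \<in> S" "x \<in> S" for q x
  proof -
    obtain \<zeta> where \<zeta>: "\<zeta> \<in> {0<..<1}" "f x = f q + grad f (q + \<zeta> *\<^sub>R (x - q)) \<bullet> (x - q)"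
      using mvt_segment[OF twice_diff_onD(1)[OF T] assms(3) qx(1), of "x - q"] qx by auto
    have "\<bar>grad f (q + \<zeta> *\<^sub>R (x - q)) \<bullet> (x - q)\<bar> \<le> norm (grad f (q + \<zeta> *\<^sub>R (x - q))) * norm (x - q)"
      by (rule Cauchy_Schwarz_ineq2)
    also have "\<dots> \<le> K * norm (x - q)" using K(2)[OF seg[OF qx \<zeta>(1)]] by (simp add: mult_right_mono)
    finally show ?thesis using \<zeta>(2) by simp
  qed
  moreover have "\<bar>f x - f q - grad f q \<bullet> (x - q)\<bar> \<le> K * (norm (x - q))\<^sup>2" if qx: "q \<in> S" "x \<in> S" for q x
  proof -
    obtain \<zeta> where \<zeta>: "\<zeta> \<in> {0<..<1}"
      "f x = f q + grad f q \<bullet> (x - q) + ((x - q) \<bullet> (hessian f (q + \<zeta> *\<^sub>R (x - q)) *v (x - q))) / 2"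
      using Taylor2_segment[OF T assms(3) qx(1), of "x - q"] qx by auto
    have "\<bar>(x - q) \<bullet> (hessian f (q + \<zeta> *\<^sub>R (x - q)) *v (x - q))\<bar> \<le> norm (x - q) * norm (hessian f (q + \<zeta> *\<^sub>R (x - q)) *v (x - q))"
      by (rule Cauchy_Schwarz_ineq2)
    also have "\<dots> \<le> norm (x - q) * (K * norm (x - q))"
      using K(3)[OF seg[OF qx \<zeta>(1)]] by (simp add: mult_left_mono)
    also have "\<dots> = K * (norm (x - q))\<^sup>2" by (simp add: power2_eq_square)
    finally have "\<bar>(x - q) \<bullet> (hessian f (q + \<zeta> *\<^sub>R (x - q)) *v (x - q))\<bar> \<le> K * (norm (x - q))\<^sup>2" .
    then show ?thesis using \<zeta>(2) by linarith
  qed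
  ultimately show ?thesis using K(1) by blast
qed

lemma bilinear_sum_le:
  fixes u :: "real ^ 'n" and v :: "real ^ 'm"
  assumes "\<And>k j. \<bar>R k j\<bar> \<le> K k j * c"
  shows "\<bar>\<Sum>k\<in>UNIV. \<Sum>j\<in>UNIV. u $ k * v $ j * R k j\<bar> \<le> (\<Sum>k\<in>UNIV. \<Sum>j\<in>UNIV. K k j) * c * norm u * norm v"
proof -
  have "\<bar>u $ k * v $ j * R k j\<bar> \<le> norm u * norm v * (K k j * c)" for k j
    unfolding abs_mult
    by (intro mult_mono component_le_norm_cart assms mult_nonneg_nonneg) auto
  then have "\<bar>\<Sum>k\<in>UNIV. \<Sum>j\<in>UNIV. u $ k * v $ j * R k j\<bar> \<le> (\<Sum>k\<in>UNIV. \<Sum>j\<in>UNIV. norm u * norm v * (K k j * c))"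
    by (intro order_trans[OF sum_abs] sum_mono)
  also have "\<dots> = (\<Sum>k\<in>UNIV. \<Sum>j\<in>UNIV. K k j) * c * norm u * norm v"
    by (simp add: sum_distrib_left sum_distrib_right mult_ac)
  finally show ?thesis .
qed

section \<open>Increments of the Hessian and symmetry of third derivatives\<close>

lemma hessian_nth: "hessian f x $ k $ j = partial_deriv j (partial_deriv k f) x"
  by (simp add: hessian_def grad_def)

lemma inner_hessian_sum:
  "u \<bullet> (hessian f x *v v) = (\<Sum>k\<in>UNIV. \<Sum>j\<in>UNIV. u $ k * v $ j * partial_deriv j (partial_deriv k f) x)"
  by (simp add: inner_vec_def matrix_vector_mult_def hessian_nth sum_distrib_left mult_ac)

text \<open>The Taylor bounds are applied to each of the finitely many second partial derivatives.
  The second estimate isolates the third derivative in direction \<open>x - q\<close>, which the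
  boundary identity controls.\<close>

lemma hessian_increment_bounds:
  fixes f :: "real ^ 'n \<Rightarrow> real"
  assumes "smooth_on U f" "compact S" "convex S" "S \<subseteq> U"
  shows "\<exists>C\<ge>0. \<forall>q\<in>S. \<forall>x\<in>S. \<forall>u v.
      \<bar>u \<bullet> (hessian f x *v v) - u \<bullet> (hessian f q *v v)\<bar> \<le> C * norm (x - q) * norm u * norm v \<and>
      \<bar>u \<bullet> (hessian f x *v v) - u \<bullet> (hessian f q *v v)
         - (\<Sum>k\<in>UNIV. \<Sum>j\<in>UNIV. u $ k * v $ j * (grad (partial_deriv j (partial_deriv k f)) q \<bullet> (x - q)))\<bar>
        \<le> C * (norm (x - q))\<^sup>2 * norm u * norm v"
proof -
  let ?D = "\<lambda>k j. partial_deriv j (partial_deriv k f)"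
  have "\<forall>k j. \<exists>K\<ge>0. \<forall>q\<in>S. \<forall>x\<in>S. \<bar>?D k j x - ?D k j q\<bar> \<le> K * norm (x - q) \<and>
      \<bar>?D k j x - ?D k j q - grad (?D k j) q \<bullet> (x - q)\<bar> \<le> K * (norm (x - q))\<^sup>2"
    using smooth_on_Taylor_bounds[OF _ assms(2-4)] smooth_on_partial_deriv assms(1) by blast
  then obtain K where K: "\<And>k j. K k j \<ge> 0"
    "\<And>k j q x. q \<in> S \<Longrightarrow> x \<in> S \<Longrightarrow> \<bar>?D k j x - ?D k j q\<bar> \<le> K k j * norm (x - q)"
    "\<And>k j q x. q \<in> S \<Longrightarrow> x \<in> S \<Longrightarrow> \<bar>?D k j x - ?D k j q - grad (?D k j) q \<bullet> (x - q)\<bar> \<le> K k j * (norm (x - q))\<^sup>2"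
    by metis
  show ?thesis
  proof (intro exI[of _ "\<Sum>k\<in>UNIV. \<Sum>j\<in>UNIV. K k j"] conjI ballI allI)
    show "0 \<le> (\<Sum>k\<in>UNIV. \<Sum>j\<in>UNIV. K k j)" using K(1) by (simp add: sum_nonneg)
    fix q x u v assume qx: "q \<in> S" "x \<in> S"
    show "\<bar>u \<bullet> (hessian f x *v v) - u \<bullet> (hessian f q *v v)\<bar> \<le> (\<Sum>k\<in>UNIV. \<Sum>j\<in>UNIV. K k j) * norm (x - q) * norm u * norm v"
      using bilinear_sum_le[OF K(2)[OF qx], of u v]
      by (simp add: inner_hessian_sum right_diff_distrib sum_subtractf)
    show "\<bar>u \<bullet> (hessian f x *v v) - u \<bullet> (hessian f q *v v)
         - (\<Sum>k\<in>UNIV. \<Sum>j\<in>UNIV. u $ k * v $ j * (grad (partial_deriv j (partial_deriv k f)) q \<bullet> (x - q)))\<bar>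
        \<le> (\<Sum>k\<in>UNIV. \<Sum>j\<in>UNIV. K k j) * (norm (x - q))\<^sup>2 * norm u * norm v"
      using bilinear_sum_le[OF K(3)[OF qx], of u v]
      by (simp add: inner_hessian_sum right_diff_distrib sum_subtractf)
  qed
qed

lemma partial_deriv_commute:
  assumes "smooth_on U f" "open U" "x \<in> U"
  shows "partial_deriv i (partial_deriv j f) x = partial_deriv j (partial_deriv i f) x"
  using symmetric_second_derivative[OF smooth_on_twice_diff_on[OF assms(1)] assms(2,3), of "axis i 1" "axis j 1"]
  by (simp add: inner_axis hessian_def matrix_vector_mul_component grad_def)

text \<open>This permits differentiating the commutation of partial derivatives, which is known on
  \<open>U\<close> only.\<close>

lemma partial_deriv_cong_open:
  assumes "smooth_on U f" "open U" "x \<in> U" "\<And>y. y \<in> U \<Longrightarrow> f y = g y"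
  shows "partial_deriv i f x = partial_deriv i g x"
proof -
  have f: "(f has_derivative (\<lambda>h. grad f x \<bullet> h)) (at x)" by (rule smooth_on_has_derivative[OF assms(1,3)])
  then have "(g has_derivative (\<lambda>h. grad f x \<bullet> h)) (at x)"
    by (rule has_derivative_transform_within_open[OF _ assms(2,3)]) (use assms(4) in auto)
  from partial_deriv_eq[OF f] partial_deriv_eq[OF this] show ?thesis by simp
qed

text \<open>Taylor expansion differentiates the entries of the Hessian, whereas
  \<open>third_derivative_identity\<close> contains Hessians of first partial derivatives. Symmetry
  of third derivatives reconciles the two.\<close>

lemma third_derivative_swap:
  fixes f :: "real ^ 'n \<Rightarrow> real"
  assumes "smooth_on U f" "open U" "q \<in> U"
  shows "(\<Sum>k\<in>UNIV. \<Sum>j\<in>UNIV. u $ k * v $ j * (grad (partial_deriv j (partial_deriv k f)) q \<bullet> w))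
    = (\<Sum>i\<in>UNIV. w $ i * (u \<bullet> (hessian (partial_deriv i f) q *v v)))"
proof -
  have "partial_deriv i (partial_deriv j (partial_deriv k f)) q = partial_deriv j (partial_deriv k (partial_deriv i f)) q" for i j k
  proof -
    have "partial_deriv i (partial_deriv j (partial_deriv k f)) q = partial_deriv j (partial_deriv i (partial_deriv k f)) q"
      by (rule partial_deriv_commute[OF smooth_on_partial_deriv[OF assms(1)] assms(2,3)])
    also have "\<dots> = partial_deriv j (partial_deriv k (partial_deriv i f)) q"
      by (rule partial_deriv_cong_open[OF _ assms(2,3)])
        (auto intro: smooth_on_partial_deriv assms partial_deriv_commute)
    finally show ?thesis .
  qed
  then have "(\<Sum>k\<in>UNIV. \<Sum>j\<in>UNIV. u $ k * v $ j * (grad (partial_deriv j (partial_deriv k f)) q \<bullet> w))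
    = (\<Sum>k\<in>UNIV. \<Sum>j\<in>UNIV. \<Sum>i\<in>UNIV. w $ i * (u $ k * v $ j * partial_deriv j (partial_deriv k (partial_deriv i f)) q))"
    by (simp add: inner_vec_def grad_def sum_distrib_left mult_ac)
  also have "\<dots> = (\<Sum>k\<in>UNIV. \<Sum>i\<in>UNIV. \<Sum>j\<in>UNIV. w $ i * (u $ k * v $ j * partial_deriv j (partial_deriv k (partial_deriv i f)) q))"
    by (intro sum.cong refl sum.swap)
  also have "\<dots> = (\<Sum>i\<in>UNIV. \<Sum>k\<in>UNIV. \<Sum>j\<in>UNIV. w $ i * (u $ k * v $ j * partial_deriv j (partial_deriv k (partial_deriv i f)) q))"
    by (rule sum.swap)
  finally show ?thesis by (simp add: inner_hessian_sum sum_distrib_left)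
qed

subsection \<open>The lower bound for the Hessian\<close>

text \<open>\<open>H\<close> stands for the Hessian at \<open>q + s *\<^sub>R \<nu>\<close> and
  \<open>A\<close> for the one at \<open>q\<close>; \<open>\<xi>\<close> is split into a tangential
  part \<open>\<tau>\<close> and a normal part with coefficient \<open>a\<close>. On
  \<open>\<tau>\<close> the change linear in \<open>s\<close> is at most \<open>P\<close>, hence
  absorbed by it, and only order \<open>s^2\<close> is lost. The cross term has order
  \<open>|a| |s| |\<tau>|\<close>, because \<open>\<nu> \<bullet> (A *v \<tau>)\<close> vanishes,
  and is divided between both parts by AM-GM.\<close>

lemma quadratic_form_lower_bound:
  fixes A H :: "real ^ 'n ^ 'n"
  assumes nu: "norm \<nu> = 1" and sym: "\<And>u v. (H *v v) \<bullet> u = (H *v u) \<bullet> v"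
    and A: "\<And>\<tau>. \<nu> \<bullet> \<tau> = 0 \<Longrightarrow> \<nu> \<bullet> (A *v \<tau>) = 0" "\<And>\<tau>. \<nu> \<bullet> \<tau> = 0 \<Longrightarrow> 0 \<le> \<tau> \<bullet> (A *v \<tau>)"
      "\<And>\<tau>. \<nu> \<bullet> \<tau> = 0 \<Longrightarrow> (norm (A *v \<tau>))\<^sup>2 \<le> K * (\<tau> \<bullet> (A *v \<tau>))" "\<bar>\<nu> \<bullet> (A *v \<nu>)\<bar> \<le> K"
    and taylor: "\<And>\<tau>. \<nu> \<bullet> \<tau> = 0 \<Longrightarrow> \<bar>\<tau> \<bullet> (H *v \<tau>) - \<tau> \<bullet> (A *v \<tau>)
         - s * ((\<nu> \<bullet> (A *v \<nu>)) * (\<tau> \<bullet> (A *v \<tau>)) - (norm (A *v \<tau>))\<^sup>2)\<bar> \<le> C * s\<^sup>2 * (norm \<tau>)\<^sup>2"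
    and lip: "\<And>\<tau>. \<bar>\<nu> \<bullet> (H *v \<tau>) - \<nu> \<bullet> (A *v \<tau>)\<bar> \<le> C * \<bar>s\<bar> * norm \<tau>"
    and H: "\<bar>\<nu> \<bullet> (H *v \<nu>)\<bar> \<le> K" and s: "2 * K * \<bar>s\<bar> \<le> 1" and C: "C \<ge> 0"
  shows "- (2 * C * s\<^sup>2 * (norm \<xi>)\<^sup>2 + (C + K) * (\<nu> \<bullet> \<xi>)\<^sup>2) \<le> \<xi> \<bullet> (H *v \<xi>)"
proof -
  define a \<tau> where "a = \<nu> \<bullet> \<xi>" and "\<tau> = \<xi> - a *\<^sub>R \<nu>"
  have nn: "\<nu> \<bullet> \<nu> = 1" using nu by (simp add: dot_square_norm)
  have \<tau>: "\<nu> \<bullet> \<tau> = 0" by (simp add: \<tau>_def a_def inner_diff_right nn)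
  have \<xi>: "\<xi> = \<tau> + a *\<^sub>R \<nu>" by (simp add: \<tau>_def)
  have "\<xi> \<bullet> \<xi> = \<tau> \<bullet> \<tau> + a\<^sup>2"
    using \<tau> by (simp add: \<xi> inner_add_left inner_add_right inner_commute nn power2_eq_square)
  then have \<tau>\<xi>: "(norm \<tau>)\<^sup>2 \<le> (norm \<xi>)\<^sup>2" by (simp add: power2_norm_eq_inner)
  define P where "P = \<tau> \<bullet> (A *v \<tau>)"
  have P: "P \<ge> 0" "(norm (A *v \<tau>))\<^sup>2 \<le> K * P" using A(2,3)[OF \<tau>] by (auto simp: P_def)
  define D where "D = (\<nu> \<bullet> (A *v \<nu>)) * P - (norm (A *v \<tau>))\<^sup>2"
  have "\<bar>(\<nu> \<bullet> (A *v \<nu>)) * P\<bar> \<le> K * P" using A(4) P(1) by (simp add: abs_mult mult_right_mono)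
  moreover have "0 \<le> (norm (A *v \<tau>))\<^sup>2" by simp
  ultimately have "\<bar>D\<bar> \<le> 2 * K * P" using P(2) unfolding D_def by linarith
  then have "\<bar>s * D\<bar> \<le> \<bar>s\<bar> * (2 * K * P)" by (simp add: abs_mult mult_left_mono)
  also have "\<dots> \<le> P" using mult_right_mono[OF s P(1)] by (simp add: mult_ac)
  finally have "\<bar>s * D\<bar> \<le> P" .
  moreover have "\<bar>\<tau> \<bullet> (H *v \<tau>) - P - s * D\<bar> \<le> C * s\<^sup>2 * (norm \<tau>)\<^sup>2"
    using taylor[OF \<tau>] by (simp add: D_def P_def)
  ultimately have tan: "\<tau> \<bullet> (H *v \<tau>) \<ge> - (C * s\<^sup>2 * (norm \<tau>)\<^sup>2)" by linarith
  have "\<bar>a * (\<nu> \<bullet> (H *v \<tau>))\<bar> \<le> \<bar>a\<bar> * (C * \<bar>s\<bar> * norm \<tau>)"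
    using lip[of \<tau>] A(1)[OF \<tau>] by (simp add: abs_mult mult_left_mono)
  also have "\<dots> = C * (\<bar>a\<bar> * (\<bar>s\<bar> * norm \<tau>))" by simp
  finally have cross1: "\<bar>a * (\<nu> \<bullet> (H *v \<tau>))\<bar> \<le> C * (\<bar>a\<bar> * (\<bar>s\<bar> * norm \<tau>))" .
  have "2 * (\<bar>a\<bar> * (\<bar>s\<bar> * norm \<tau>)) \<le> a\<^sup>2 + s\<^sup>2 * (norm \<tau>)\<^sup>2"
    using sum_squares_bound[of "\<bar>a\<bar>" "\<bar>s\<bar> * norm \<tau>"] by (simp add: power_mult_distrib)
  from mult_left_mono[OF this C] have cross2: "2 * (C * (\<bar>a\<bar> * (\<bar>s\<bar> * norm \<tau>))) \<le> C * a\<^sup>2 + C * s\<^sup>2 * (norm \<tau>)\<^sup>2"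
    by (simp add: algebra_simps)
  have nor: "\<bar>a\<^sup>2 * (\<nu> \<bullet> (H *v \<nu>))\<bar> \<le> K * a\<^sup>2"
    using mult_left_mono[OF H, of "a\<^sup>2"] by (simp add: abs_mult mult.commute)
  have "\<xi> \<bullet> (H *v \<xi>) = \<tau> \<bullet> (H *v \<tau>) + 2 * (a * (\<nu> \<bullet> (H *v \<tau>))) + a\<^sup>2 * (\<nu> \<bullet> (H *v \<nu>))"
    using sym[of \<nu> \<tau>]
    by (simp add: \<xi> matrix_vector_right_distrib matrix_vector_mult_scaleR inner_add_left inner_add_right inner_commute
        power2_eq_square algebra_simps)
  then have "\<xi> \<bullet> (H *v \<xi>) \<ge> - (2 * (C * s\<^sup>2 * (norm \<tau>)\<^sup>2)) - C * a\<^sup>2 - K * a\<^sup>2"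
    using tan cross1 cross2 nor by linarith
  moreover have "C * s\<^sup>2 * (norm \<tau>)\<^sup>2 \<le> C * s\<^sup>2 * (norm \<xi>)\<^sup>2" using \<tau>\<xi> C by (intro mult_left_mono) auto
  ultimately show ?thesis by (simp add: a_def algebra_simps)
qed

text \<open>The preceding estimate is used at a nearest frontier point \<open>q\<close> of
  \<open>x\<close>. It remains to trade \<open>s\<close> for \<open>\<sigma> x\<close> and the
  normal at \<open>q\<close> for the gradient at \<open>x\<close>, at the cost of constants.\<close>

lemma hessian_lower_bound_near_frontier:
  fixes \<Omega> U :: "(real ^ 'n) set"
  assumes "open \<Omega>" and p: "p \<in> frontier \<Omega>" "p \<in> U" and U: "open U"
    and \<sigma>: "smooth_on U \<sigma>" "local_defining_function \<sigma> \<Omega> U"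
    and unit: "\<forall>x \<in> frontier \<Omega> \<inter> U. norm (grad \<sigma> x) = 1" and conv: "convex_boundary_on \<Omega> U"
  shows "\<exists>\<rho>>0. \<exists>M>0. ball p \<rho> \<subseteq> U \<and> (\<forall>x\<in>ball p \<rho>. \<forall>\<xi>.
     - (M * ((\<sigma> x)\<^sup>2 * (norm \<xi>)\<^sup>2 + (grad \<sigma> x \<bullet> \<xi>)\<^sup>2)) \<le> \<xi> \<bullet> (hessian \<sigma> x *v \<xi>))"
proof -
  obtain R where R: "R > 0" "cball p R \<subseteq> U" using U p(2) open_contains_cball by blast
  define S where "S = cball p R"
  have S: "compact S" "convex S" "S \<subseteq> U" using R by (auto simp: S_def)
  obtain K1 where K1: "K1 \<ge> 0" "\<And>x v. x \<in> S \<Longrightarrow> norm (hessian \<sigma> x *v v) \<le> K1 * norm v"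
    using smooth_on_derivative_bounds[OF \<sigma>(1) S(1,3)] by auto
  obtain K2 where K2: "K2 \<ge> 0" "\<And>q x. q \<in> S \<Longrightarrow> x \<in> S \<Longrightarrow> \<bar>\<sigma> x - \<sigma> q - grad \<sigma> q \<bullet> (x - q)\<bar> \<le> K2 * (norm (x - q))\<^sup>2"
    using smooth_on_Taylor_bounds[OF \<sigma>(1) S] by auto
  have T: "twice_diff_on U \<sigma> (grad \<sigma>) (hessian \<sigma>)" by (rule smooth_on_twice_diff_on[OF \<sigma>(1)])
  obtain C where C: "C \<ge> 0" and
    C1: "\<And>q x u v. q \<in> S \<Longrightarrow> x \<in> S \<Longrightarrow>
      \<bar>u \<bullet> (hessian \<sigma> x *v v) - u \<bullet> (hessian \<sigma> q *v v)\<bar> \<le> C * norm (x - q) * norm u * norm v" and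
    C2: "\<And>q x u v. q \<in> S \<Longrightarrow> x \<in> S \<Longrightarrow> \<bar>u \<bullet> (hessian \<sigma> x *v v) - u \<bullet> (hessian \<sigma> q *v v)
         - (\<Sum>k\<in>UNIV. \<Sum>j\<in>UNIV. u $ k * v $ j * (grad (partial_deriv j (partial_deriv k \<sigma>)) q \<bullet> (x - q)))\<bar>
        \<le> C * (norm (x - q))\<^sup>2 * norm u * norm v"
    using hessian_increment_bounds[OF \<sigma>(1) S]
    by - (erule exE, erule conjE, rule that, assumption, blast, blast)
  define K where "K = K1 + K2 + 1"
  have K: "K \<ge> 1" using K1 K2 by (simp add: K_def)
  have K1': "norm (hessian \<sigma> x *v v) \<le> K * norm v" if "x \<in> S" for x v
    using K1(2)[OF that, of v] mult_right_mono[of K1 K "norm v"] K2(1) by (simp add: K_def)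
  have K1'': "\<bar>u \<bullet> (hessian \<sigma> x *v v)\<bar> \<le> K * norm u * norm v" if "x \<in> S" for x u v
    using order_trans[OF Cauchy_Schwarz_ineq2 mult_left_mono[OF K1'[OF that, of v] norm_ge_zero[of u]]]
    by (simp add: mult_ac)
  have K2': "\<bar>\<sigma> x - \<sigma> q - grad \<sigma> q \<bullet> (x - q)\<bar> \<le> K * (norm (x - q))\<^sup>2" if "q \<in> S" "x \<in> S" for q x
    using K2(2)[OF that] mult_right_mono[of K2 K "(norm (x - q))\<^sup>2"] K1(1) by (simp add: K_def)
  \<comment> \<open>The bound \<open>R / 2\<close> forces the nearest frontier point into
    \<open>S\<close>; the bound \<open>1 / (2 * K)\<close> gives the smallness of \<open>s\<close>
    in \<open>sK\<close>.\<close>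
  define \<rho> where "\<rho> = min (R / 2) (1 / (2 * K))"
  have "1 / (2 * K) > 0" using K by simp
  then have \<rho>: "\<rho> > 0" "2 * \<rho> \<le> R" "2 * K * \<rho> \<le> 1"
    using R(1) K by (auto simp: \<rho>_def min_def field_simps)
  \<comment> \<open>The factor 4 comes from \<open>s\<sigma>\<close>, and the multiples of
    \<open>C + K\<close> come from replacing \<open>\<nu> \<bullet> \<xi>\<close> by means of the
    estimate \<open>a\<close>.\<close>
  define M where "M = 4 * (2 * C + 2 * K\<^sup>2 * (C + K)) + 2 * (C + K)"
  have M: "M > 0" using C K by (simp add: M_def add_nonneg_pos)
  have zero: "\<sigma> y = 0" if "y \<in> frontier \<Omega> \<inter> U" for y
    using local_defining_function_zero[OF \<sigma>(2) twice_diff_on_continuous(1)[OF T] assms(1) that] .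
  obtain r where r: "defining_function r \<Omega>"
    "\<And>q \<tau>. q \<in> frontier \<Omega> \<inter> U \<Longrightarrow> \<tau> \<in> tangent_space r q \<Longrightarrow> 0 \<le> hessian_form r q \<tau>"
    using conv by (auto simp: convex_boundary_on_def)
  have bound: "- (M * ((\<sigma> x)\<^sup>2 * (norm \<xi>)\<^sup>2 + (grad \<sigma> x \<bullet> \<xi>)\<^sup>2)) \<le> \<xi> \<bullet> (hessian \<sigma> x *v \<xi>)"
    if x: "x \<in> ball p \<rho>" for x \<xi>
  proof -
    obtain q where q: "q \<in> frontier \<Omega>" "\<And>y. y \<in> frontier \<Omega> \<Longrightarrow> dist x q \<le> dist x y"
      using distance_attains_inf[OF frontier_closed, of \<Omega> x] p(1) by blast
    \<comment> \<open>Since \<open>p\<close> is itself a frontier point, the nearest one is no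
      farther from \<open>x\<close> than \<open>p\<close>.\<close>
    have xq: "dist x q < \<rho>" using q(2)[OF p(1)] x by (simp add: dist_commute)
    have "dist p q < R" using dist_triangle[of p q x] xq x \<rho> by simp
    then have qS: "q \<in> S" and xS: "x \<in> S" using x \<rho> by (auto simp: S_def)
    then have qU: "q \<in> U" and xU: "x \<in> U" using S by auto
    obtain e where e: "e > 0" "ball q e \<subseteq> U" using U qU open_contains_ball by blast
    define \<nu> where "\<nu> = grad \<sigma> q"
    have nu: "norm \<nu> = 1" using unit q(1) qU by (simp add: \<nu>_def)
    interpret boundary_point \<Omega> \<sigma> q e \<nu>
    proof
      show "local_defining_function \<sigma> \<Omega> (ball q e)" using \<sigma>(2) e(2) by (auto simp: local_defining_function_def)
      show "\<sigma> q = 0" using zero q(1) qU by simp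
      show "(\<sigma> has_derivative (\<bullet>) \<nu>) (at q)" unfolding \<nu>_def by (rule twice_diff_onD(1)[OF T qU])
    qed (use e q nu in auto)
    have sm: "smooth_on (ball q e) \<sigma>"
      using \<sigma>(1) e(2) smooth_on_subset by blast
    have zero': "\<sigma> y = 0" if "y \<in> frontier \<Omega> \<inter> ball q e" for y using zero that e(2) by blast
    have unit': "norm (grad \<sigma> y) = 1" if "y \<in> frontier \<Omega> \<inter> ball q e" for y using unit that e(2) by blast
    define s where "s = (x - q) \<bullet> \<nu>"
    have xs: "x - q = s *\<^sub>R \<nu>" unfolding s_def by (rule nearest_point_normal[OF q(2)])
    have ns: "norm (x - q) = \<bar>s\<bar>" using xs nu by simp
    have sK: "2 * K * \<bar>s\<bar> \<le> 1"
    proof -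
      have "\<bar>s\<bar> \<le> \<rho>" using ns xq by (simp add: dist_norm)
      then have "2 * K * \<bar>s\<bar> \<le> 2 * K * \<rho>" using K by (intro mult_left_mono) auto
      then show ?thesis using \<rho>(3) by simp
    qed
    define A where "A = hessian \<sigma> q"
    have symA: "(A *v v) \<bullet> u = (A *v u) \<bullet> v" for u v
      unfolding A_def by (rule symmetric_second_derivative[OF T U qU])
    have A1: "\<nu> \<bullet> (A *v \<tau>) = 0" if "\<nu> \<bullet> \<tau> = 0" for \<tau>
      unfolding A_def by (rule third_derivative_identity(1)[OF sm zero' unit' that])
    have A2: "0 \<le> \<tau> \<bullet> (A *v \<tau>)" if "\<nu> \<bullet> \<tau> = 0" for \<tau>
      unfolding A_def
      by (rule hessian_nonneg_on_tangent_space[OF twice_diff_on_subset[OF T e(2)] zero' r(1) _ that])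
        (use r(2) q(1) qU in auto)
    have A3: "(norm (A *v \<tau>))\<^sup>2 \<le> K * (\<tau> \<bullet> (A *v \<tau>))" if "\<nu> \<bullet> \<tau> = 0" for \<tau>
    proof (rule psd_norm_le[where T = "{w. \<nu> \<bullet> w = 0}"])
      show "w \<bullet> (A *v w) \<le> K * (norm w)\<^sup>2" for w
        using K1''[OF qS, of w w] by (simp add: A_def power2_eq_square)
      show "subspace {w. \<nu> \<bullet> w = 0}" by (rule subspace_hyperplane)
    qed (use symA A2 A1 K that in auto)
    have L: "- (2 * C * s\<^sup>2 * (norm \<xi>)\<^sup>2 + (C + K) * (\<nu> \<bullet> \<xi>)\<^sup>2) \<le> \<xi> \<bullet> (hessian \<sigma> x *v \<xi>)"
    proof (rule quadratic_form_lower_bound[OF nu _ A1 A2 A3 _ _ _ _ sK C])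
      show "(hessian \<sigma> x *v v) \<bullet> u = (hessian \<sigma> x *v u) \<bullet> v" for u v
        by (rule symmetric_second_derivative[OF T U xU])
      show "\<bar>\<nu> \<bullet> (A *v \<nu>)\<bar> \<le> K" using K1''[OF qS, of \<nu> \<nu>] nu by (simp add: A_def)
      show "\<bar>\<nu> \<bullet> (hessian \<sigma> x *v \<nu>)\<bar> \<le> K" using K1''[OF xS, of \<nu> \<nu>] nu by simp
      show "\<bar>\<nu> \<bullet> (hessian \<sigma> x *v \<tau>) - \<nu> \<bullet> (A *v \<tau>)\<bar> \<le> C * \<bar>s\<bar> * norm \<tau>" for \<tau>
        using C1[OF qS xS, of \<nu> \<tau>] nu ns by (simp add: A_def)
      fix \<tau> assume \<tau>: "\<nu> \<bullet> \<tau> = 0"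
      have "(\<Sum>k\<in>UNIV. \<Sum>j\<in>UNIV. \<tau> $ k * \<tau> $ j * (grad (partial_deriv j (partial_deriv k \<sigma>)) q \<bullet> (x - q)))
        = s * (\<Sum>k\<in>UNIV. \<Sum>j\<in>UNIV. \<tau> $ k * \<tau> $ j * (grad (partial_deriv j (partial_deriv k \<sigma>)) q \<bullet> \<nu>))"
        by (simp add: xs sum_distrib_left mult_ac)
      also have "\<dots> = s * ((\<nu> \<bullet> (A *v \<nu>)) * (\<tau> \<bullet> (A *v \<tau>)) - (norm (A *v \<tau>))\<^sup>2)"
        unfolding third_derivative_swap[OF \<sigma>(1) U qU] A_def
        by (rule arg_cong[OF third_derivative_identity(2)[OF sm zero' unit' \<tau>]])
      finally show "\<bar>\<tau> \<bullet> (hessian \<sigma> x *v \<tau>) - \<tau> \<bullet> (A *v \<tau>)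
         - s * ((\<nu> \<bullet> (A *v \<nu>)) * (\<tau> \<bullet> (A *v \<tau>)) - (norm (A *v \<tau>))\<^sup>2)\<bar> \<le> C * s\<^sup>2 * (norm \<tau>)\<^sup>2"
        using C2[OF qS xS, of \<tau> \<tau>] ns by (simp add: A_def power2_eq_square mult_ac)
    qed
    \<comment> \<open>As \<open>\<sigma> q = 0\<close> and the gradient at \<open>q\<close> is the
      unit normal, \<open>\<sigma> x\<close> differs from \<open>s\<close> by at most
      \<open>K * s^2\<close>, which is at most half of \<open>|s|\<close>.\<close>
    have s\<sigma>: "s\<^sup>2 \<le> 4 * (\<sigma> x)\<^sup>2"
    proof -
      have "\<bar>\<sigma> x - s\<bar> \<le> K * s\<^sup>2"
        using K2'[OF qS xS] sigma_q xs nu_nu nu by (simp add: \<nu>_def[symmetric])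
      also have "2 * (K * s\<^sup>2) \<le> \<bar>s\<bar>"
        using mult_right_mono[OF sK, of "\<bar>s\<bar>"] by (simp add: power2_eq_square mult_ac)
      then have "K * s\<^sup>2 \<le> \<bar>s\<bar> / 2" by simp
      finally have "\<bar>s\<bar> \<le> \<bar>2 * \<sigma> x\<bar>" by linarith
      then have "s\<^sup>2 \<le> (2 * \<sigma> x)\<^sup>2" by (simp only: abs_le_square_iff)
      then show ?thesis by (simp add: power_mult_distrib)
    qed
    \<comment> \<open>The gradients at \<open>x\<close> and \<open>q\<close> differ by at most order
      \<open>|s|\<close>; the elementary inequality for \<open>y\<close> and \<open>z\<close> turns
      this into an estimate of squares.\<close>
    have a: "(\<nu> \<bullet> \<xi>)\<^sup>2 \<le> 2 * (grad \<sigma> x \<bullet> \<xi>)\<^sup>2 + 2 * (K\<^sup>2 * (s\<^sup>2 * (norm \<xi>)\<^sup>2))"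
    proof -
      have "\<bar>grad \<sigma> x \<bullet> \<xi> - \<nu> \<bullet> \<xi>\<bar> \<le> K * \<bar>s\<bar> * norm \<xi>"
      proof -
        have "((\<lambda>y. \<xi> \<bullet> grad \<sigma> y) has_derivative (\<lambda>h. (\<xi> v* hessian \<sigma> y) \<bullet> h)) (at y)" if "y \<in> S" for y
          using has_derivative_inner_right[OF twice_diff_onD(2)[OF T], of y \<xi>] that S(3)
          by (auto simp: dot_lmul_matrix)
        from mvt_segment[OF this S(2) qS, of "x - q"] xS obtain \<zeta> where \<zeta>: "\<zeta> \<in> {0<..<1}"
          "\<xi> \<bullet> grad \<sigma> x = \<xi> \<bullet> grad \<sigma> q + \<xi> \<bullet> (hessian \<sigma> (q + \<zeta> *\<^sub>R (x - q)) *v (x - q))"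
          by (auto simp: dot_lmul_matrix)
        have "q + \<zeta> *\<^sub>R (x - q) \<in> S"
          using convexD_alt[OF S(2) qS xS, of \<zeta>] \<zeta>(1) by (simp add: algebra_simps)
        from K1''[OF this, of \<xi> "x - q"] \<zeta>(2) show ?thesis
          by (simp add: \<nu>_def ns inner_commute[of _ \<xi>] mult_ac)
      qed
      then have "(grad \<sigma> x \<bullet> \<xi> - \<nu> \<bullet> \<xi>)\<^sup>2 \<le> (K * \<bar>s\<bar> * norm \<xi>)\<^sup>2"
        using abs_le_square_iff[of "grad \<sigma> x \<bullet> \<xi> - \<nu> \<bullet> \<xi>" "K * \<bar>s\<bar> * norm \<xi>"] K by simp
      moreover have "y\<^sup>2 \<le> 2 * z\<^sup>2 + 2 * (z - y)\<^sup>2" for y z :: real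
        using zero_le_power2[of "2 * z - y"] by (simp add: power2_eq_square algebra_simps)
      from this[of "\<nu> \<bullet> \<xi>" "grad \<sigma> x \<bullet> \<xi>"]
      have "(\<nu> \<bullet> \<xi>)\<^sup>2 \<le> 2 * (grad \<sigma> x \<bullet> \<xi>)\<^sup>2 + 2 * (grad \<sigma> x \<bullet> \<xi> - \<nu> \<bullet> \<xi>)\<^sup>2" .
      ultimately show ?thesis by (simp add: power_mult_distrib)
    qed
    define b where "b = (grad \<sigma> x \<bullet> \<xi>)\<^sup>2"
    have "2 * C * s\<^sup>2 * (norm \<xi>)\<^sup>2 + (C + K) * (\<nu> \<bullet> \<xi>)\<^sup>2
        \<le> 2 * C * s\<^sup>2 * (norm \<xi>)\<^sup>2 + (C + K) * (2 * b + 2 * (K\<^sup>2 * (s\<^sup>2 * (norm \<xi>)\<^sup>2)))"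
      using a C K by (simp add: b_def mult_left_mono)
    also have "\<dots> = (2 * C + 2 * K\<^sup>2 * (C + K)) * (s\<^sup>2 * (norm \<xi>)\<^sup>2) + 2 * (C + K) * b"
      by (simp add: algebra_simps)
    also have "\<dots> \<le> (2 * C + 2 * K\<^sup>2 * (C + K)) * (4 * ((\<sigma> x)\<^sup>2 * (norm \<xi>)\<^sup>2)) + 2 * (C + K) * b"
      using mult_right_mono[OF s\<sigma>, of "(norm \<xi>)\<^sup>2"] C K by (intro add_right_mono mult_left_mono) auto
    also have "\<dots> \<le> M * ((\<sigma> x)\<^sup>2 * (norm \<xi>)\<^sup>2) + M * b"
    proof (rule add_mono)
      have M: "(2 * C + 2 * K\<^sup>2 * (C + K)) * 4 \<le> M" "2 * (C + K) \<le> M" using C K by (simp_all add: M_def)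
      have "0 \<le> (\<sigma> x)\<^sup>2 * (norm \<xi>)\<^sup>2" "0 \<le> b" by (simp_all add: b_def)
      from mult_right_mono[OF M(1) this(1)] mult_right_mono[OF M(2) this(2)]
      show "(2 * C + 2 * K\<^sup>2 * (C + K)) * (4 * ((\<sigma> x)\<^sup>2 * (norm \<xi>)\<^sup>2)) \<le> M * ((\<sigma> x)\<^sup>2 * (norm \<xi>)\<^sup>2)"
        "2 * (C + K) * b \<le> M * b"
        by (simp_all only: mult.assoc)
    qed
    finally show ?thesis using L by (simp add: b_def distrib_left)
  qed
  have "ball p \<rho> \<subseteq> U" using \<rho> R by (auto simp: subset_eq)
  then show ?thesis using bound \<rho>(1) M by blast
qed

text \<open>In the application \<open>Q\<close> is the Hessian form of \<open>\<sigma>\<close> on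
  \<open>\<xi>\<close>, \<open>N\<close> and \<open>X\<close> are the norms of \<open>\<xi>\<close>
  and \<open>x\<close>, and \<open>b\<close> and \<open>c\<close> are the products of
  \<open>\<xi>\<close> with \<open>grad \<sigma> x\<close> and with \<open>x\<close>. Half of the
  last term pays for the \<open>\<sigma>^2\<close> defect of \<open>Q\<close>, which fixes
  \<open>\<beta>\<close>. The other half and part of the \<open>b^2\<close> term pay for the mixed
  term. The bound on \<open>\<alpha>\<close> makes the coefficient of \<open>b^2\<close> at least
  \<open>3 * M / 2 + 16 * \<beta> * X^2\<close>.\<close>

lemma sigma_tilde_quadratic_bound:
  fixes Q N b c \<sigma> M \<alpha> \<beta> X :: real
  assumes low: "- (M * (\<sigma>\<^sup>2 * N\<^sup>2 + b\<^sup>2)) \<le> Q"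
    and small: "\<bar>2 * (\<alpha> + \<beta> * X\<^sup>2) * \<sigma>\<bar> \<le> 1 / 2" and c: "\<bar>c\<bar> \<le> X * N" and M: "M > 0"
    and \<beta>: "\<beta> = 3 * M / 2" and \<alpha>: "3 * M / 4 + 7 * \<beta> * X\<^sup>2 \<le> \<alpha>"
  shows "0 \<le> (1 + 2 * (\<alpha> + \<beta> * X\<^sup>2) * \<sigma>) * Q + 2 * (\<alpha> + \<beta> * X\<^sup>2) * b\<^sup>2 + 8 * \<beta> * \<sigma> * c * b + 2 * \<beta> * \<sigma>\<^sup>2 * N\<^sup>2"
proof -
  define k where "k = 1 + 2 * (\<alpha> + \<beta> * X\<^sup>2) * \<sigma>"
  \<comment> \<open>The defect in \<open>low\<close> is thus enlarged by a factor of at most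
    3/2.\<close>
  have k: "0 \<le> k" "k \<le> 3 / 2" using small by (auto simp: k_def abs_le_iff)
  have "- (3 / 2 * (M * (\<sigma>\<^sup>2 * N\<^sup>2 + b\<^sup>2))) \<le> - (k * (M * (\<sigma>\<^sup>2 * N\<^sup>2 + b\<^sup>2)))"
    using mult_right_mono[OF k(2), of "M * (\<sigma>\<^sup>2 * N\<^sup>2 + b\<^sup>2)"] M by simp
  also have "\<dots> \<le> k * Q" using mult_left_mono[OF low k(1)] by simp
  finally have 1: "- (3 / 2 * (M * (\<sigma>\<^sup>2 * N\<^sup>2 + b\<^sup>2))) \<le> k * Q" .
  \<comment> \<open>The weight 4 makes the mixed term cost exactly one copy of
    \<open>\<beta> * \<sigma>^2 * N^2\<close>.\<close>
  have "0 \<le> (\<sigma> * N + 4 * X * b)\<^sup>2" "0 \<le> (\<sigma> * N - 4 * X * b)\<^sup>2" by simp_all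
  then have "8 * \<bar>(\<sigma> * N) * (X * b)\<bar> \<le> \<sigma>\<^sup>2 * N\<^sup>2 + 16 * X\<^sup>2 * b\<^sup>2"
    by (simp add: power2_eq_square algebra_simps abs_if)
  moreover have "\<bar>\<sigma> * c * b\<bar> \<le> \<bar>(\<sigma> * N) * (X * b)\<bar>"
    using mult_left_mono[OF order_trans[OF c abs_ge_self], of "\<bar>\<sigma> * b\<bar>"] by (simp add: abs_mult mult_ac)
  ultimately have "8 * (\<sigma> * c * b) \<ge> - (\<sigma>\<^sup>2 * N\<^sup>2 + 16 * X\<^sup>2 * b\<^sup>2)" by linarith
  moreover have "\<beta> \<ge> 0" using M \<beta> by simp
  ultimately have 2: "8 * \<beta> * \<sigma> * c * b \<ge> - (\<beta> * (\<sigma>\<^sup>2 * N\<^sup>2)) - 16 * \<beta> * X\<^sup>2 * b\<^sup>2"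
    using mult_left_mono[of "- (\<sigma>\<^sup>2 * N\<^sup>2 + 16 * X\<^sup>2 * b\<^sup>2)" "8 * (\<sigma> * c * b)" \<beta>] by (simp add: algebra_simps)
  have "(3 * M / 4 + 7 * \<beta> * X\<^sup>2) * b\<^sup>2 \<le> \<alpha> * b\<^sup>2" using \<alpha> by (simp add: mult_right_mono)
  then have 3: "2 * (\<alpha> + \<beta> * X\<^sup>2) * b\<^sup>2 \<ge> 3 / 2 * (M * b\<^sup>2) + 16 * \<beta> * X\<^sup>2 * b\<^sup>2" by (simp add: algebra_simps)
  have 4: "2 * \<beta> * \<sigma>\<^sup>2 * N\<^sup>2 = \<beta> * (\<sigma>\<^sup>2 * N\<^sup>2) + 3 / 2 * (M * (\<sigma>\<^sup>2 * N\<^sup>2))" by (simp add: \<beta>)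
  have "- (3 / 2 * (M * (\<sigma>\<^sup>2 * N\<^sup>2))) - 3 / 2 * (M * b\<^sup>2) \<le> k * Q"
    using 1 by (simp add: distrib_left)
  then show ?thesis using 2 3 4 unfolding k_def[symmetric] by linarith
qed

theorem proposition6p17:
  fixes \<Omega> U :: "(real ^ 'n) set" and p :: "real ^ 'n" and \<sigma> :: "real ^ 'n \<Rightarrow> real"
  assumes "smoothly_bounded \<Omega>" and "connected \<Omega>"
    and "p \<in> frontier \<Omega>"
    and "open U" and "p \<in> U"
    and "smooth_on U \<sigma>" and "local_defining_function \<sigma> \<Omega> U"
    and "\<forall>x \<in> frontier \<Omega> \<inter> U. norm (grad \<sigma> x) = 1"
    and "convex_boundary_on \<Omega> U"
  shows "\<exists>W \<alpha> \<beta>. open W \<and> p \<in> W \<and> W \<subseteq> U \<and> \<alpha> > 0 \<and> \<beta> > 0 \<and>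
           local_defining_function (sigma_tilde \<sigma> \<alpha> \<beta>) \<Omega> W \<and>
           (\<forall>x\<in>W. \<forall>\<xi>. hessian_form (sigma_tilde \<sigma> \<alpha> \<beta>) x \<xi> \<ge> 0)"
proof -
  have "open \<Omega>" using assms(1) by (simp add: smoothly_bounded_def)
  obtain \<rho> M where \<rho>: "\<rho> > 0" "ball p \<rho> \<subseteq> U" and M: "M > 0" and
    low: "\<And>x \<xi>. x \<in> ball p \<rho> \<Longrightarrow>
     - (M * ((\<sigma> x)\<^sup>2 * (norm \<xi>)\<^sup>2 + (grad \<sigma> x \<bullet> \<xi>)\<^sup>2)) \<le> \<xi> \<bullet> (hessian \<sigma> x *v \<xi>)"
    using hessian_lower_bound_near_frontier[OF \<open>open \<Omega>\<close> assms(3,5,4,6-9)] by blast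
  \<comment> \<open>\<open>X\<close> bounds the norm on the unit ball around \<open>p\<close>. Hence
    \<open>\<alpha>\<close> and \<open>\<beta>\<close> depend only on \<open>p\<close> and
    \<open>M\<close> and are fixed before the neighborhood shrinks to \<open>W\<close>.\<close>
  define X where "X = norm p + 1"
  define \<beta> where "\<beta> = 3 * M / 2"
  define \<alpha> where "\<alpha> = 3 * M / 4 + 7 * \<beta> * X\<^sup>2"
  have pos: "\<beta> > 0" "\<alpha> > 0" using M by (auto simp: \<beta>_def \<alpha>_def intro!: add_pos_nonneg)
  have T: "twice_diff_on U \<sigma> (grad \<sigma>) (hessian \<sigma>)" by (rule smooth_on_twice_diff_on[OF assms(6)])
  have "\<sigma> p = 0"
    using local_defining_function_zero[OF assms(7) twice_diff_on_continuous(1)[OF T] \<open>open \<Omega>\<close>] assms(3,5) by simp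
  moreover have "isCont \<sigma> p"
    using twice_diff_on_continuous(1)[OF T] assms(4,5) by (simp add: continuous_on_eq_continuous_at)
  ultimately have lim: "(\<lambda>x. 2 * B \<alpha> \<beta> x * \<sigma> x) \<midarrow>p\<rightarrow> 2 * B \<alpha> \<beta> p * 0"
    unfolding B_def isCont_def by (intro tendsto_intros) simp
  have "\<forall>\<^sub>F x in at p. \<bar>2 * B \<alpha> \<beta> x * \<sigma> x\<bar> < 1 / 2"
    using tendstoD[OF lim, of "1 / 2"] by simp
  then obtain d where d: "d > 0" "\<And>x. x \<noteq> p \<Longrightarrow> dist x p < d \<Longrightarrow> \<bar>2 * B \<alpha> \<beta> x * \<sigma> x\<bar> < 1 / 2"
    unfolding eventually_at by auto
  \<comment> \<open>The radius \<open>\<rho>\<close> provides \<open>low\<close>, \<open>d\<close>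
    makes \<open>2 * B \<alpha> \<beta> x * \<sigma> x\<close> small, and 1 keeps the norm below
    \<open>X\<close>.\<close>
  define W where "W = ball p (min (min \<rho> d) 1)"
  have W: "open W" "p \<in> W" "W \<subseteq> U" "W \<subseteq> ball p \<rho>" using \<rho> d by (auto simp: W_def)
  have small: "\<bar>2 * B \<alpha> \<beta> x * \<sigma> x\<bar> \<le> 1 / 2" if "x \<in> W" for x
    using d(2)[of x] that \<open>\<sigma> p = 0\<close> by (cases "x = p") (auto simp: W_def dist_commute)
  have nX: "norm x \<le> X" if "x \<in> W" for x
    using that norm_triangle_sub[of x p] by (simp add: W_def X_def dist_norm norm_minus_commute)
  have "local_defining_function (sigma_tilde \<sigma> \<alpha> \<beta>) \<Omega> W"
    unfolding local_defining_function_def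
  proof
    have "sigma_tilde \<sigma> \<alpha> \<beta> x < 0 \<longleftrightarrow> \<sigma> x < 0" if "x \<in> W" for x
    proof -
      \<comment> \<open>The first factor is positive on \<open>W\<close>, so
        \<open>sigma_tilde\<close> has the sign of \<open>\<sigma>\<close> there.\<close>
      have "sigma_tilde \<sigma> \<alpha> \<beta> x = (1 + B \<alpha> \<beta> x * \<sigma> x) * \<sigma> x"
        by (simp add: sigma_tilde_def power2_eq_square algebra_simps)
      moreover have "1 + B \<alpha> \<beta> x * \<sigma> x > 0" using small[OF that] by (simp add: abs_le_iff)
      ultimately show ?thesis by (simp add: mult_less_0_iff)
    qed
    moreover have "\<Omega> \<inter> U = {x \<in> U. \<sigma> x < 0}" using assms(7) by (simp add: local_defining_function_def)
    ultimately show "\<Omega> \<inter> W = {x \<in> W. sigma_tilde \<sigma> \<alpha> \<beta> x < 0}" using W(3) by blast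
  qed (rule W)
  moreover have "hessian_form (sigma_tilde \<sigma> \<alpha> \<beta>) x \<xi> \<ge> 0" if x: "x \<in> W" for x \<xi>
  proof -
    \<comment> \<open>Composing the differentiation rules instantiates \<open>g\<close> and
      \<open>H\<close> by unification, so the Hessian of the modified function is computed rather
      than written out.\<close>
    have "twice_diff_on U (\<lambda>x. \<sigma> x + (\<alpha> + \<beta> * (norm x)\<^sup>2) * (\<sigma> x * \<sigma> x)) g H \<Longrightarrow>
      hessian_form (sigma_tilde \<sigma> \<alpha> \<beta>) x \<xi> = \<xi> \<bullet> (H x *v \<xi>)" for g H
      using hessian_form_eq[of U "sigma_tilde \<sigma> \<alpha> \<beta>" g H x \<xi>] assms(4) W(3) x
      by (auto simp: sigma_tilde_def[abs_def] B_def[abs_def] power2_eq_square)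
    note hessian = this[OF twice_diff_on_add[OF T twice_diff_on_mult[OF twice_diff_on_add[OF twice_diff_on_const
        twice_diff_on_cmult[OF twice_diff_on_norm_power2]] twice_diff_on_mult[OF T T]]]]
    have "hessian_form (sigma_tilde \<sigma> \<alpha> \<beta>) x \<xi> =
      (1 + 2 * (\<alpha> + \<beta> * (norm x)\<^sup>2) * \<sigma> x) * (\<xi> \<bullet> (hessian \<sigma> x *v \<xi>)) + 2 * (\<alpha> + \<beta> * (norm x)\<^sup>2) * (grad \<sigma> x \<bullet> \<xi>)\<^sup>2
       + 8 * \<beta> * \<sigma> x * (x \<bullet> \<xi>) * (grad \<sigma> x \<bullet> \<xi>) + 2 * \<beta> * (\<sigma> x)\<^sup>2 * (norm \<xi>)\<^sup>2"
      unfolding hessian matrix_vector_mult_add_rdistrib scaleR_matrix_vector_mult outer_mult_vec mat_mult_vec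
           matrix_vector_mult_0
           inner_add_left inner_add_right inner_scaleR_left inner_scaleR_right inner_zero_left inner_zero_right
           inner_commute[of \<xi> "grad \<sigma> x"] inner_commute[of \<xi> x] power2_norm_eq_inner[of \<xi>]
      by algebra
    also have "\<dots> \<ge> 0"
    proof (rule sigma_tilde_quadratic_bound[OF low _ _ M \<beta>_def])
      show "x \<in> ball p \<rho>" using x W(4) by blast
      show "\<bar>2 * (\<alpha> + \<beta> * (norm x)\<^sup>2) * \<sigma> x\<bar> \<le> 1 / 2" using small[OF x] by (simp add: B_def)
      show "\<bar>x \<bullet> \<xi>\<bar> \<le> norm x * norm \<xi>" by (rule Cauchy_Schwarz_ineq2)
      have "(norm x)\<^sup>2 \<le> X\<^sup>2" using nX[OF x] by (intro power_mono) auto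
      then show "3 * M / 4 + 7 * \<beta> * (norm x)\<^sup>2 \<le> \<alpha>" using pos(1) by (simp add: \<alpha>_def)
    qed
    finally show ?thesis .
  qed
  ultimately show ?thesis using W pos by blast
qed

end
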